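(* Let $s=(s(1),\dots,s(n))$ be a weak composition, $\overleftarrow{s}=(s(n),\dots,s(1))$ and $\nu=\nu(\overleftarrow{s})=NE^{s(n)}NE^{s(n-1)}\cdots NE^{s(1)}$. The map $\overline{\varphi}$ sending a pure $s$-Tamari interval $[T,T+A]$ to the covering $\nu$-face $\varphi(T)\smallsetminus\mathcal A$, where $\mathcal A$ is the set of $\nu$-ascents of the $\nu$-tree $\varphi(T)$ corresponding to $A$, is an isomorphism between the $s$-associahedron $\operatorname{Asso}(s)$ and the $\nu(\overleftarrow{s})$-associahedron $\operatorname{Asso}(\nu(\overleftarrow{s}))$; that is, $\overline\varphi$ is a bijection between the faces of $\operatorname{Asso}(s)$ and those of $\operatorname{Asso}(\nu)$, and $[T,T+A]\subseteq[T',T'+A']$ if and only if $\overline\varphi([T,T+A])\supseteq\overline\varphi([T',T'+A'])$.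
   Context: $s$-side. A weak composition of length $n$ is a sequence $s=(s(1),\dots,s(n))$ of non-negative integers. An $s$-decreasing tree is a rooted planar tree with $n$ internal nodes labeled bijectively by $1,\dots,n$ (leaves are unlabeled) such that node $i$ has exactly $s(i)+1$ ordered children and labels decrease from root to leaves; $T^y_0,\dots,T^y_{s(y)}$ denote the child subtrees of $y$ from left to right. For nodes $a<c$, $\#_T(c,a)$ is $0$ if $a$ is left of $c$ or in $T^c_0$; $i$ if $a$ is in $T^c_i$ with $0<i<s(c)$; $s(c)$ if $a$ is in $T^c_{s(c)}$ or right of $c$. $\operatorname{inv}(T)$ is the multi-set in which $(c,a)$ occurs $\#_T(c,a)$ times; it determines $T$. The $s$-weak order is: $R\preccurlyeq T$ iff $\#_R(c,a)\le\#_T(c,a)$ for all $a<c$. An $s$-Tamari tree is an $s$-decreasing tree with $\#_T(c,a)\le\#_T(c,b)$ for all $a<b<c$. The $s$-Tamari lattice is the restriction of the $s$-weak order to $s$-Tamari trees. A Tamari-ascent of an $s$-Tamari tree $T$ is a pair $(a,c)$, $a<c$, such that $a$ is a non-right child of $c$, i.e. $a$ is the root of $T^c_i$ with $i<s(c)$. The transitive closure $I^{\mathsf{tc}}$ of a multi-set $I$ of pairs $(c,a)$, $a<c$, has $\#_{I^{\mathsf{tc}}}(c,a)$ equal to the maximum of $\#_I(b_1,b_2)$ over all lists $c=b_1>\dots>b_k=a$, $k\ge2$, with all $\#_I(b_i,b_{i+1})>0$ ($0$ if none). For a (possibly empty) set $A$ of Tamari-ascents of $T$, $T+A$ is the $s$-Tamari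 tree whose tree-inversion multi-set is obtained from $\operatorname{inv}(T)$ by increasing $\#_T(c,a)$ by one for each $(a,c)\in A$ and then taking the transitive closure; for $A=\{(a,c)\}$ this is the $s$-Tamari rotation of $T$ at $(a,c)$, and these rotations are exactly the cover relations of the $s$-Tamari lattice. A pure $s$-Tamari interval is an interval $[T,T+A]$ of the $s$-Tamari lattice of this form. $\operatorname{Asso}(s)$ is the collection of pure $s$-Tamari intervals (faces), ordered by inclusion of intervals in the $s$-Tamari lattice; $[T,T+A]$ has dimension $|A|$. $\nu$-side. Let $\nu$ be a lattice path of unit north ($N$) and east ($E$) steps, of length $\ell(\nu)$. $A_\nu$ is the set of lattice points weakly above $\nu$ inside the smallest rectangle containing $\nu$. Points $p,q\in A_\nu$ are $\nu$-incompatible if $p$ is (strictly) southwest or northeast of $q$ and the south-east corner of the smallest rectangle containing $p,q$ is weakly above $\nu$; otherwise they are $\nu$-compatible. A $\nu$-tree is a maximal collection of pairwise $\nu$-compatible elements of $A_\nu$. For $p,r$ in a $\nu$-tree $\mathcal T$ not in the same row or column, let $p\square r$ be the smallest rectangle containing them. If $q\in\mathcal T$ is the lower left corner of $p\square r$ and no elements of $\mathcal T$ other than $p,q,r$ lie in $p\square r$, then $q$ is a $\nu$-ascent of $\mathcal T$, and the rotation of $\mathcal T$ at $q$ is the $\nu$-tree $(\mathcal T\smallsetminus\{q\})\cup\{q'\}$ with $q'$ the upper right corner of $p\square r$. The $\nu$-Tamari lattice is the lattice on $\nu$-trees whose cover relations are the rotations. A $\nu$-face is a set of pairwise $\nu$-compatible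 elements of $A_\nu$; it is covering if it contains the top left corner of $A_\nu$ and at least one point in each row and each column. $\operatorname{Asso}(\nu)$ is the complex of covering $\nu$-faces ordered by reversed inclusion; a covering $\nu$-face $\mathcal F$ has dimension $\ell(\nu)+1-|\mathcal F|$. The map $\varphi$. For an $s$-Tamari tree $T$, label all nodes of $T$ (internal nodes and leaves) by numbers in $\{0,1,\dots,n\}$: traverse $T$ in reverse preorder (a node first, then its children subtrees from right to left), and give a node $x$ the label $i$ if exactly $i$ internal nodes are traversed strictly before $x$. Then $\varphi(T)$ is the unique $\nu(\overleftarrow s)$-tree having, for each $i$, as many points at height $i$ (bottom row being height $0$) as there are nodes of $T$ with label $i$. It is known that $\varphi$ is an isomorphism from the $s$-Tamari lattice to the $\nu(\overleftarrow s)$-Tamari lattice; hence each Tamari-ascent $(a,c)$ of $T$ corresponds to a unique $\nu$-ascent $q$ of $\varphi(T)$, namely the one such that $\varphi$ of the $s$-Tamari rotation of $T$ at $(a,c)$ is the rotation of $\varphi(T)$ at $q$. For a set $A$ of Tamari-ascents of $T$, $\mathcal A$ is the corresponding set of $\nu$-ascents. *)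

theory Defs
  imports Main "HOL-Library.Multiset"
begin

section \<open>The \<open>s\<close>-associahedron\<close>

text \<open>A weak composition of length \<open>n\<close> is a list \<open>s :: nat list\<close> with \<open>length s = n\<close>.
  Lists are indexed from 0, hence the shift.\<close>

definition part :: "nat list \<Rightarrow> nat \<Rightarrow> nat" where
  "part s i = s ! (i - 1)"

datatype stree = Leaf | Node nat "stree list"

fun labels :: "stree \<Rightarrow> nat list" where
  "labels Leaf = []"
| "labels (Node y ts) = y # concat (map labels ts)"

fun subtrees :: "stree \<Rightarrow> stree set" where
  "subtrees Leaf = {Leaf}"
| "subtrees (Node y ts) = insert (Node y ts) (\<Union>t\<in>set ts. subtrees t)"

definition decreasing_tree :: "nat list \<Rightarrow> stree \<Rightarrow> bool" where
  "decreasing_tree s T \<longleftrightarrow>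
     distinct (labels T) \<and> set (labels T) = {1..length s} \<and>
     (\<forall>y ts. Node y ts \<in> subtrees T \<longrightarrow>
        length ts = part s y + 1 \<and> (\<forall>t\<in>set ts. \<forall>a\<in>set (labels t). a < y))"

text \<open>\<open>in_child T c i a\<close>: node \<open>a\<close> lies in the child subtree \<open>T\<^sup>c\<^sub>i\<close>.\<close>

definition in_child :: "stree \<Rightarrow> nat \<Rightarrow> nat \<Rightarrow> nat \<Rightarrow> bool" where
  "in_child T c i a \<longleftrightarrow>
     (\<exists>ts. Node c ts \<in> subtrees T \<and> i < length ts \<and> a \<in> set (labels (ts ! i)))"

definition left_of :: "stree \<Rightarrow> nat \<Rightarrow> nat \<Rightarrow> bool" where
  "left_of T a c \<longleftrightarrow> (\<exists>y i j. i < j \<and> in_child T y i a \<and> in_child T y j c)"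

definition card_inv :: "nat list \<Rightarrow> stree \<Rightarrow> nat \<Rightarrow> nat \<Rightarrow> nat" where
  "card_inv s T c a =
     (if left_of T a c \<or> in_child T c 0 a then 0
      else if left_of T c a \<or> in_child T c (part s c) a then part s c
      else (THE i. in_child T c i a))"

definition label_pairs :: "nat list \<Rightarrow> (nat \<times> nat) set" where
  "label_pairs s = {(c, a). 1 \<le> a \<and> a < c \<and> c \<le> length s}"

definition tree_inv :: "nat list \<Rightarrow> stree \<Rightarrow> (nat \<times> nat) multiset" where
  "tree_inv s T = (\<Sum>(c, a)\<in>label_pairs s. replicate_mset (card_inv s T c a) (c, a))"

lemma finite_label_pairs: "finite (label_pairs s)"
  by (rule finite_subset[of _ "{1..length s} \<times> {1..length s}"]) (auto simp: label_pairs_def)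

lemma count_tree_inv:
  "count (tree_inv s T) (c, a) = (if (c, a) \<in> label_pairs s then card_inv s T c a else 0)"
proof -
  have "count (tree_inv s T) (c, a) =
      (\<Sum>p\<in>label_pairs s. if p = (c, a) then card_inv s T c a else 0)"
    unfolding tree_inv_def count_sum by (rule sum.cong) (auto split: prod.splits)
  then show ?thesis
    using finite_label_pairs by simp
qed

definition weak_le :: "nat list \<Rightarrow> stree \<Rightarrow> stree \<Rightarrow> bool" where
  "weak_le s R T \<longleftrightarrow> (\<forall>(c, a)\<in>label_pairs s. card_inv s R c a \<le> card_inv s T c a)"

definition tamari_tree :: "nat list \<Rightarrow> stree \<Rightarrow> bool" where
  "tamari_tree s T \<longleftrightarrow> decreasing_tree s T \<and>
     (\<forall>a b c. 1 \<le> a \<and> a < b \<and> b < c \<and> c \<le> length s \<longrightarrow>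
        card_inv s T c a \<le> card_inv s T c b)"

definition tamari_interval :: "nat list \<Rightarrow> stree \<Rightarrow> stree \<Rightarrow> stree set" where
  "tamari_interval s T T' = {R. tamari_tree s R \<and> weak_le s T R \<and> weak_le s R T'}"

definition tamari_ascents :: "nat list \<Rightarrow> stree \<Rightarrow> (nat \<times> nat) set" where
  "tamari_ascents s T =
     {(a, c). a < c \<and>
        (\<exists>ts i us. Node c ts \<in> subtrees T \<and> i < part s c \<and> ts ! i = Node a us)}"

definition inv_chains :: "(nat \<times> nat) multiset \<Rightarrow> nat \<Rightarrow> nat \<Rightarrow> nat list set" where
  "inv_chains I c a =
     {b. 2 \<le> length b \<and> hd b = c \<and> last b = a \<and> sorted_wrt (>) b \<and>
         (\<forall>i. i + 1 < length b \<longrightarrow> 0 < count I (b ! i, b ! (i + 1)))}"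

definition trans_closure :: "(nat \<times> nat) multiset \<Rightarrow> (nat \<times> nat) multiset" where
  "trans_closure I =
     Abs_multiset (\<lambda>(c, a). Max (insert 0 ((\<lambda>b. count I (b ! 0, b ! 1)) ` inv_chains I c a)))"

text \<open>The function passed to \<open>Abs_multiset\<close> has finite support, so it is the multiplicity
  function of the transitive closure; moreover the maximum is over a finite set.\<close>

lemma finite_chain_counts: "finite ((\<lambda>b. count I (b ! 0, b ! 1)) ` inv_chains I c a)"
proof (rule finite_subset)
  show "(\<lambda>b. count I (b ! 0, b ! 1)) ` inv_chains I c a \<subseteq> count I ` set_mset I"
  proof
    fix m assume "m \<in> (\<lambda>b. count I (b ! 0, b ! 1)) ` inv_chains I c a"
    then obtain b where b: "b \<in> inv_chains I c a" "m = count I (b ! 0, b ! 1)" by blast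
    then have "0 < count I (b ! 0, b ! (0 + 1))" unfolding inv_chains_def by fastforce
    then show "m \<in> count I ` set_mset I" using b(2) by auto
  qed
qed simp

lemma count_trans_closure:
  "count (trans_closure I) (c, a) =
     Max (insert 0 ((\<lambda>b. count I (b ! 0, b ! 1)) ` inv_chains I c a))"
proof -
  let ?f = "\<lambda>(c, a). Max (insert 0 ((\<lambda>b. count I (b ! 0, b ! 1)) ` inv_chains I c a))"
  have "{x. 0 < ?f x} \<subseteq> fst ` set_mset I \<times> snd ` set_mset I"
  proof clarify
    fix c a assume pos: "0 < Max (insert 0 ((\<lambda>b. count I (b ! 0, b ! 1)) ` inv_chains I c a))"
    then have "inv_chains I c a \<noteq> {}" by (intro notI) simp
    then obtain b where b: "2 \<le> length b" "hd b = c" "last b = a"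
      and ch: "\<And>i. i + 1 < length b \<Longrightarrow> 0 < count I (b ! i, b ! (i + 1))"
      unfolding inv_chains_def by blast
    have "b \<noteq> []" using b(1) by auto
    have "(c, b ! 1) \<in># I" using ch[of 0] b \<open>b \<noteq> []\<close> by (simp add: hd_conv_nth)
    moreover have "(b ! (length b - 2), a) \<in># I"
      using ch[of "length b - 2"] b \<open>b \<noteq> []\<close>
      by (simp add: last_conv_nth Suc_diff_le numeral_2_eq_2 Suc_diff_Suc)
    ultimately show "c \<in> fst ` set_mset I \<and> a \<in> snd ` set_mset I" by force
  qed
  then have "finite {x. 0 < ?f x}" by (rule finite_subset) simp
  then have "count (Abs_multiset ?f) = ?f" by (rule count_Abs_multiset)
  then show ?thesis unfolding trans_closure_def by simp
qed

text \<open>\<open>tree_plus s T A\<close> is \<open>T + A\<close>. Ascents are written \<open>(a, c)\<close> but inversions \<open>(c, a)\<close>.\<close>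

definition tree_plus :: "nat list \<Rightarrow> stree \<Rightarrow> (nat \<times> nat) set \<Rightarrow> stree" where
  "tree_plus s T A =
     (THE R. tamari_tree s R \<and>
        tree_inv s R = trans_closure (tree_inv s T + mset_set (prod.swap ` A)))"

definition asso_s :: "nat list \<Rightarrow> stree set set" where
  "asso_s s =
     {tamari_interval s T (tree_plus s T A) | T A. tamari_tree s T \<and> A \<subseteq> tamari_ascents s T}"


section \<open>The \<open>\<nu>\<close>-associahedron\<close>

datatype step = North | East

type_synonym point = "nat \<times> nat"

text \<open>Points are pairs (column, row); paths start at the origin.\<close>

definition path_width :: "step list \<Rightarrow> nat" where
  "path_width \<nu> = count_list \<nu> East"

definition path_height :: "step list \<Rightarrow> nat" where
  "path_height \<nu> = count_list \<nu> North"

definition path_points :: "step list \<Rightarrow> point set" where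
  "path_points \<nu> = (\<lambda>k. (path_width (take k \<nu>), path_height (take k \<nu>))) ` {..length \<nu>}"

definition weakly_above :: "step list \<Rightarrow> point \<Rightarrow> bool" where
  "weakly_above \<nu> p \<longleftrightarrow> (\<exists>y \<le> snd p. (fst p, y) \<in> path_points \<nu>)"

definition region :: "step list \<Rightarrow> point set" where
  "region \<nu> = {p \<in> {0..path_width \<nu>} \<times> {0..path_height \<nu>}. weakly_above \<nu> p}"

definition southwest :: "point \<Rightarrow> point \<Rightarrow> bool" where
  "southwest p q \<longleftrightarrow> fst p < fst q \<and> snd p < snd q"

definition rect :: "point \<Rightarrow> point \<Rightarrow> point set" where
  "rect p q =
     {min (fst p) (fst q)..max (fst p) (fst q)} \<times> {min (snd p) (snd q)..max (snd p) (snd q)}"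

definition se_corner :: "point \<Rightarrow> point \<Rightarrow> point" where
  "se_corner p q = (max (fst p) (fst q), min (snd p) (snd q))"

definition sw_corner :: "point \<Rightarrow> point \<Rightarrow> point" where
  "sw_corner p q = (min (fst p) (fst q), min (snd p) (snd q))"

definition ne_corner :: "point \<Rightarrow> point \<Rightarrow> point" where
  "ne_corner p q = (max (fst p) (fst q), max (snd p) (snd q))"

definition incompatible :: "step list \<Rightarrow> point \<Rightarrow> point \<Rightarrow> bool" where
  "incompatible \<nu> p q \<longleftrightarrow>
     (southwest p q \<or> southwest q p) \<and> weakly_above \<nu> (se_corner p q)"

definition nu_face :: "step list \<Rightarrow> point set \<Rightarrow> bool" where
  "nu_face \<nu> F \<longleftrightarrow> F \<subseteq> region \<nu> \<and> pairwise (\<lambda>p q. \<not> incompatible \<nu> p q) F"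

definition nu_tree :: "step list \<Rightarrow> point set \<Rightarrow> bool" where
  "nu_tree \<nu> F \<longleftrightarrow> nu_face \<nu> F \<and> (\<forall>F'. nu_face \<nu> F' \<and> F \<subseteq> F' \<longrightarrow> F' = F)"

text \<open>\<open>nu_rotation F q F'\<close>: \<open>q\<close> is a \<open>\<nu>\<close>-ascent of \<open>F\<close> and \<open>F'\<close> is the rotation of \<open>F\<close> at \<open>q\<close>.
  The points \<open>p\<close>, \<open>q\<close>, \<open>r\<close> have to be distinct: if \<open>p\<close> is southwest of \<open>r\<close>, then
  the lower left corner of their rectangle is \<open>p\<close> itself, and this does not define an ascent.\<close>

definition nu_rotation :: "point set \<Rightarrow> point \<Rightarrow> point set \<Rightarrow> bool" where
  "nu_rotation F q F' \<longleftrightarrow>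
     (\<exists>p\<in>F. \<exists>r\<in>F. fst p \<noteq> fst r \<and> snd p \<noteq> snd r \<and>
        q \<in> F \<and> q = sw_corner p r \<and> q \<noteq> p \<and> q \<noteq> r \<and>
        F \<inter> rect p r \<subseteq> {p, q, r} \<and>
        F' = (F - {q}) \<union> {ne_corner p r})"

definition covering :: "step list \<Rightarrow> point set \<Rightarrow> bool" where
  "covering \<nu> F \<longleftrightarrow> (0, path_height \<nu>) \<in> F \<and>
     (\<forall>y \<le> path_height \<nu>. \<exists>x. (x, y) \<in> F) \<and> (\<forall>x \<le> path_width \<nu>. \<exists>y. (x, y) \<in> F)"

definition asso_nu :: "step list \<Rightarrow> point set set" where
  "asso_nu \<nu> = {F. nu_face \<nu> F \<and> covering \<nu> F}"

definition path_of :: "nat list \<Rightarrow> step list" where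
  "path_of t = concat (map (\<lambda>k. North # replicate k East) t)"


section \<open>The maps \<open>\<phi>\<close> and \<open>\<phi>\<close>-bar\<close>

text \<open>Every node (internal node or leaf) is represented by the subtree rooted at it; the list
  may contain repetitions, so nodes are identified by their position in the list.\<close>

fun rev_preorder :: "stree \<Rightarrow> stree list" where
  "rev_preorder Leaf = [Leaf]"
| "rev_preorder (Node y ts) = Node y ts # concat (map rev_preorder (rev ts))"

definition node_label :: "stree \<Rightarrow> nat \<Rightarrow> nat" where
  "node_label T k = length (filter (\<lambda>t. t \<noteq> Leaf) (take k (rev_preorder T)))"

definition phi :: "nat list \<Rightarrow> stree \<Rightarrow> point set" where
  "phi s T =
     (THE F. nu_tree (path_of (rev s)) F \<and>
        (\<forall>i. card {p \<in> F. snd p = i} =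
             card {k. k < length (rev_preorder T) \<and> node_label T k = i}))"

definition nu_ascent_of :: "nat list \<Rightarrow> stree \<Rightarrow> nat \<times> nat \<Rightarrow> point" where
  "nu_ascent_of s T ac = (THE q. nu_rotation (phi s T) q (phi s (tree_plus s T {ac})))"

definition phi_bar :: "nat list \<Rightarrow> stree set \<Rightarrow> point set" where
  "phi_bar s I =
     (THE F. \<exists>T A. tamari_tree s T \<and> A \<subseteq> tamari_ascents s T \<and>
        I = tamari_interval s T (tree_plus s T A) \<and> F = phi s T - nu_ascent_of s T ` A)"

end

theory Submission
  imports Defs
begin

text \<open>
  Both sides are governed by \<^emph>\<open>bracket functions\<close> \<open>h\<close>, which assign to every column of the region
  above \<open>\<nu>\<close> the height of the topmost point in that column; compatibility of these points is a
  condition on \<open>h\<close> alone. A \<open>\<nu>\<close>-tree consists of the column tops and, in each row \<open>i < n\<close>, of the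
  leftmost point, whose column is forced by \<open>h\<close>. A covering face misses the leftmost points of some
  set \<open>R\<close> of rows that also contain column tops, so covering faces are the same as pairs \<open>(h, R)\<close>.

  In an \<open>s\<close>-Tamari tree the internal nodes are visited in the order \<open>n, \<dots>, 1\<close> by the reverse
  preorder traversal. If the first child of a node inherits its column and the other ones open new
  columns, the rows of the leaves define a bracket function \<open>h\<close>, and \<open>\<phi>(T)\<close> is the \<open>\<nu>\<close>-tree of \<open>h\<close>.
  The inversion numbers count how many of the columns opened by a node reach a given row, so that the
  \<open>s\<close>-weak order becomes the pointwise order; the ascents of \<open>T\<close> correspond to the rows
  that contain a column top. Finally \<open>Q \<in> [T, T + A]\<close> if and only if \<open>\<phi>(Q)\<close> contains the face
  \<open>\<phi>(T) - \<A>\<close>, and this face is \<open>\<phi>(T) \<inter> \<phi>(T + A)\<close>; hence it is the intersection of all \<open>\<phi>(Q)\<close>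
  with \<open>Q\<close> in the interval, and inclusion of intervals is reversed inclusion of faces.
\<close>

section \<open>Points weakly above a path\<close>

lemma path_width_append: "path_width (p @ q) = path_width p + path_width q"
  by (simp add: path_width_def)

lemma path_height_append: "path_height (p @ q) = path_height p + path_height q"
  by (simp add: path_height_def)

lemma path_points_append:
  "path_points (p @ q) =
     path_points p \<union> (\<lambda>(x, y). (path_width p + x, path_height p + y)) ` path_points q"
proof -
  have split: "{..length (p @ q)} = {..length p} \<union> (\<lambda>k. length p + k) ` {..length q}"
  proof (intro equalityI subsetI)
    fix k assume "k \<in> {..length (p @ q)}"
    then show "k \<in> {..length p} \<union> (\<lambda>k. length p + k) ` {..length q}"
      by (cases "k \<le> length p") (auto intro: image_eqI[of _ _ "k - length p"])
  qed auto
  show ?thesis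
    unfolding path_points_def split image_Un image_image
    by (intro arg_cong2[where f = "(\<union>)"] image_cong)
      (auto simp: path_width_append path_height_append)
qed

lemma path_points_block:
  "path_points (North # replicate k East) = insert (0, 0) ((\<lambda>j. (j, 1)) ` {..k})"
proof -
  have split: "{..Suc k} = insert 0 (Suc ` {..k})"
    by (rule atMost_Suc_eq_insert_0)
  have cE: "count_list (replicate m East) East = m" for m
    by (induction m) auto
  have cN: "count_list (replicate m East) North = 0" for m
    by (induction m) auto
  show ?thesis
    unfolding path_points_def length_Cons length_replicate split image_insert image_image
    by (intro arg_cong2[where f = insert] image_cong)
      (auto simp: path_width_def path_height_def take_replicate cE cN min_def)
qed

lemma path_width_path_of: "path_width (path_of t) = sum_list t"
proof -
  have "count_list (replicate m East) East = m" for m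
    by (induction m) auto
  then show ?thesis
    by (induction t) (simp_all add: path_of_def path_width_def)
qed

lemma path_height_path_of: "path_height (path_of t) = length t"
proof -
  have "count_list (replicate m East) North = 0" for m
    by (induction m) auto
  then show ?thesis
    by (induction t) (simp_all add: path_of_def path_height_def)
qed

text \<open>Appending a block adds path points only in the new top row, so row \<open>y\<close>
  extends to the column reached by the first \<open>y\<close> blocks. As \<open>take\<close>
  saturates, the formula also covers rows above the path.\<close>

lemma weakly_above_path_of:
  "weakly_above (path_of t) (x, y) \<longleftrightarrow> x \<le> sum_list (take y t)"
proof (induction t arbitrary: y rule: rev_induct)
  case Nil
  show ?case
    by (auto simp: weakly_above_def path_of_def path_points_def path_width_def path_height_def)
next
  case (snoc k t)
  have "path_points (path_of (t @ [k])) =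
      path_points (path_of t) \<union> {(sum_list t, length t)} \<union>
      (\<lambda>j. (sum_list t + j, Suc (length t))) ` {..k}"
    using path_points_append[of "path_of t" "North # replicate k East"]
    by (simp add: path_of_def path_points_block image_image image_Un
        path_width_path_of[unfolded path_of_def] path_height_path_of[unfolded path_of_def] Un_assoc)
  moreover have "(sum_list t, length t) \<in> path_points (path_of t)"
    unfolding path_points_def
    by (rule image_eqI[of _ _ "length (path_of t)"])
      (simp_all add: path_width_path_of path_height_path_of)
  ultimately have pts: "path_points (path_of (t @ [k])) =
      path_points (path_of t) \<union> (\<lambda>j. (sum_list t + j, Suc (length t))) ` {..k}"
    by auto
  have "weakly_above (path_of (t @ [k])) (x, y) \<longleftrightarrow>
      weakly_above (path_of t) (x, y) \<or>
      Suc (length t) \<le> y \<and> sum_list t \<le> x \<and> x \<le> sum_list t + k"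
  proof -
    have "(\<exists>j\<le>k. x = sum_list t + j) \<longleftrightarrow> sum_list t \<le> x \<and> x \<le> sum_list t + k"
      by (auto intro: exI[of _ "x - sum_list t"])
    then show ?thesis
      unfolding weakly_above_def pts by auto
  qed
  then show ?case
    unfolding snoc.IH by (cases "y \<le> length t") auto
qed

text \<open>Two upward closed subsets of a linear order are nested, so in the finite case equal
  cardinality makes them equal.\<close>

lemma upper_sets_eq:
  fixes X Y V :: "nat set"
  assumes "finite V" "X \<subseteq> V" "Y \<subseteq> V" "card X = card Y"
    "\<And>x y. x \<in> X \<Longrightarrow> y \<in> V \<Longrightarrow> x < y \<Longrightarrow> y \<in> X"
    "\<And>x y. x \<in> Y \<Longrightarrow> y \<in> V \<Longrightarrow> x < y \<Longrightarrow> y \<in> Y"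
  shows "X = Y"
proof -
  have fin: "finite X" "finite Y" using assms finite_subset by blast+
  have "X \<subseteq> Y \<or> Y \<subseteq> X"
    using assms(2,3,5,6) by (metis linorder_neqE_nat subsetD subsetI)
  then show ?thesis using assms(4) fin card_subset_eq by metis
qed

section \<open>Bracket functions and \<open>\<nu>\<close>-trees\<close>

locale weak_composition =
  fixes s :: "nat list"
begin

abbreviation n :: nat where
  "n \<equiv> length s"

text \<open>The last column of row \<open>k\<close> of the region. From row \<open>n - c\<close> to
  the next one the region gains \<open>part s c\<close> columns, which will be the ones opened by
  node \<open>c\<close>.\<close>

definition S :: "nat \<Rightarrow> nat" where
  "S k = sum_list (take k (rev s))"

abbreviation W :: nat where
  "W \<equiv> S n"

lemma S_0 [simp]: "S 0 = 0"
  by (simp add: S_def)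

lemma S_Suc: "k < n \<Longrightarrow> S (Suc k) = S k + part s (n - k)"
  by (simp add: S_def take_Suc_conv_app_nth rev_nth part_def)

lemma S_mono: "i \<le> j \<Longrightarrow> S i \<le> S j"
proof -
  assume "i \<le> j"
  then have "take j (rev s) = take i (rev s) @ drop i (take j (rev s))"
    by (metis append_take_drop_id min.absorb2 take_take min.commute)
  then have "S j = S i + sum_list (drop i (take j (rev s)))"
    unfolding S_def by (metis sum_list_append)
  then show ?thesis by simp
qed

lemma S_le_W: "S i \<le> W"
  by (cases "i \<le> n") (auto simp: S_mono, simp add: S_def)

lemma less_of_S_less: "S i < S j \<Longrightarrow> i < j"
  using S_mono[of j i] by force

lemma region_path: "region (path_of (rev s)) = {(x, y). y \<le> n \<and> x \<le> S y}"
  using S_le_W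
  by (auto simp: region_def path_width_path_of path_height_path_of weakly_above_path_of
      S_def[symmetric]) (auto simp: S_def intro: order_trans)

lemma incompatible_path:
  "incompatible (path_of (rev s)) (x, y) (x', y') \<longleftrightarrow>
     x < x' \<and> y < y' \<and> x' \<le> S y \<or> x' < x \<and> y' < y \<and> x \<le> S y'"
  by (auto simp: incompatible_def southwest_def se_corner_def weakly_above_path_of
      S_def[symmetric] max_def min_def)

text \<open>A bracket function records, for every column, the height of its topmost point.\<close>

definition bracket :: "(nat \<Rightarrow> nat) \<Rightarrow> bool" where
  "bracket h \<longleftrightarrow> h 0 = n \<and> (\<forall>x\<le>W. h x \<le> n \<and> x \<le> S (h x)) \<and> (\<forall>x>W. h x = 0) \<and>
     (\<forall>x x'. x < x' \<and> x' \<le> S (h x) \<longrightarrow> h x' \<le> h x)"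

lemma bracket_0: "bracket h \<Longrightarrow> h 0 = n"
  by (simp add: bracket_def)

lemma bracket_le: "bracket h \<Longrightarrow> h x \<le> n"
  by (cases "x \<le> W") (auto simp: bracket_def)

lemma bracket_below: "bracket h \<Longrightarrow> x \<le> W \<Longrightarrow> x \<le> S (h x)"
  by (auto simp: bracket_def)

lemma bracket_outside: "bracket h \<Longrightarrow> W < x \<Longrightarrow> h x = 0"
  by (auto simp: bracket_def)

lemma bracket_nested: "bracket h \<Longrightarrow> x < x' \<Longrightarrow> x' \<le> S (h x) \<Longrightarrow> h x' \<le> h x"
  by (auto simp: bracket_def)

lemma bracket_eqI:
  assumes "bracket h" "bracket k" "\<And>x. x \<le> W \<Longrightarrow> h x = k x"
  shows "h = k"
  using assms bracket_outside by (metis ext not_le)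

text \<open>The name refers to points: a point \<open>(x, i)\<close> below the top of its column is
  compatible with the tops to its right only if no column in \<open>{x<..S i}\<close> passes above
  row \<open>i\<close>. So \<open>x\<close> is the last column that does, hence \<open>Max\<close>;
  the tops in row \<open>i\<close> lie further right.\<close>

definition leftmost :: "(nat \<Rightarrow> nat) \<Rightarrow> nat \<Rightarrow> nat" where
  "leftmost h i = Max {x. x \<le> S i \<and> i < h x}"

lemma
  assumes "bracket h" "i < n"
  shows leftmost_le: "leftmost h i \<le> S i"
    and less_leftmost: "i < h (leftmost h i)"
    and leftmost_ge: "\<And>x. x \<le> S i \<Longrightarrow> i < h x \<Longrightarrow> x \<le> leftmost h i"
proof -
  let ?X = "{x. x \<le> S i \<and> i < h x}"
  have fin: "finite ?X" by simp
  have "0 \<in> ?X" using assms by (simp add: bracket_0)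
  then have "leftmost h i \<in> ?X"
    unfolding leftmost_def using fin by (metis Max_in empty_iff)
  then show "leftmost h i \<le> S i" "i < h (leftmost h i)" by auto
  show "x \<le> leftmost h i" if "x \<le> S i" "i < h x" for x
    unfolding leftmost_def using fin that by (intro Max_ge) auto
qed

lemma leftmost_le_W: "bracket h \<Longrightarrow> i < n \<Longrightarrow> leftmost h i \<le> W"
  using leftmost_le S_le_W order_trans by blast

lemma leftmost_eqI:
  assumes "bracket h" "i < n" "x \<le> S i" "i < h x" "\<And>z. z \<le> S i \<Longrightarrow> i < h z \<Longrightarrow> z \<le> x"
  shows "leftmost h i = x"
  using assms leftmost_le less_leftmost leftmost_ge by (meson antisym)

text \<open>Otherwise nestedness at \<open>x\<close> would hold the column
  \<open>leftmost h i\<close> down to row \<open>i\<close>.\<close>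

lemma leftmost_less:
  assumes "bracket h" "x \<le> W" "h x = i" "i < n"
  shows "leftmost h i < x"
proof (rule ccontr)
  assume "\<not> ?thesis"
  moreover have "leftmost h i \<noteq> x"
    using less_leftmost[of h i] assms by auto
  ultimately have "h (leftmost h i) \<le> i"
    using bracket_nested[of h x "leftmost h i"] leftmost_le[of h i] assms by auto
  then show False using less_leftmost[of h i] assms by auto
qed

section \<open>Trees of bracket functions: compatibility and cardinality\<close>

definition tree :: "(nat \<Rightarrow> nat) \<Rightarrow> point set" where
  "tree h = {(x, y). x \<le> W \<and> (y = h x \<or> y < n \<and> x = leftmost h y)}"

lemma top_in_tree: "x \<le> W \<Longrightarrow> (x, h x) \<in> tree h"
  by (simp add: tree_def)

lemma leftmost_in_tree: "bracket h \<Longrightarrow> i < n \<Longrightarrow> (leftmost h i, i) \<in> tree h"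
  by (simp add: tree_def leftmost_le_W)

lemma tree_le_top: "bracket h \<Longrightarrow> (x, y) \<in> tree h \<Longrightarrow> y \<le> h x"
  using less_leftmost[of h y] by (auto simp: tree_def)

lemma tree_below: "bracket h \<Longrightarrow> (x, y) \<in> tree h \<Longrightarrow> x \<le> S y"
  using leftmost_le[of h y] by (auto simp: tree_def bracket_below)

lemma tree_le_n: "bracket h \<Longrightarrow> (x, y) \<in> tree h \<Longrightarrow> y \<le> n"
  using tree_le_top bracket_le order_trans by blast

text \<open>It suffices to bound the top of column \<open>x'\<close>. If \<open>(x, y)\<close> is a
  top, this is nestedness; if it is a leftmost point, it is the maximality of its column.\<close>

lemma tree_compatible:
  assumes "bracket h" "(x, y) \<in> tree h" "(x', y') \<in> tree h" "x < x'" "x' \<le> S y"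
  shows "y' \<le> y"
proof -
  have "h x' \<le> y"
  proof (cases "y = h x")
    case True
    then show ?thesis using assms bracket_nested by blast
  next
    case False
    then have "y < n" "x = leftmost h y"
      using assms(2) by (auto simp: tree_def)
    then show ?thesis
      using leftmost_ge[of h y x'] assms(1,4,5) by (meson not_le)
  qed
  then show ?thesis using tree_le_top[of h x' y'] assms by simp
qed

lemma nu_face_tree: "bracket h \<Longrightarrow> nu_face (path_of (rev s)) (tree h)"
  using tree_compatible tree_below tree_le_n
  by (auto simp: nu_face_def region_path pairwise_def incompatible_path) (meson leD)+

lemma tree_eq: "bracket h \<Longrightarrow> tree h = (\<lambda>x. (x, h x)) ` {..W} \<union> (\<lambda>i. (leftmost h i, i)) ` {..<n}"
  by (auto simp: tree_def leftmost_le_W)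

lemma finite_tree: "bracket h \<Longrightarrow> finite (tree h)"
  by (simp add: tree_eq)

text \<open>A leftmost point lies strictly below the top of its column, so the two families of
  points are disjoint. The count is independent of \<open>h\<close>, which later yields
  maximality.\<close>

lemma card_tree:
  assumes "bracket h"
  shows "card (tree h) = Suc W + n"
proof -
  have "(\<lambda>x. (x, h x)) ` {..W} \<inter> (\<lambda>i. (leftmost h i, i)) ` {..<n} = {}"
    using less_leftmost[OF assms] by fastforce
  then show ?thesis
    unfolding tree_eq[OF assms]
    by (subst card_Un_disjoint) (auto simp: card_image inj_on_def)
qed

section \<open>Recovering the bracket function from the column tops of a face\<close>

definition tops :: "point set \<Rightarrow> nat \<Rightarrow> nat" where
  "tops F x = (if x \<le> W then Max {y. (x, y) \<in> F} else 0)"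

lemma
  assumes F: "nu_face (path_of (rev s)) F" and x: "x \<le> W" and ex: "\<exists>y. (x, y) \<in> F"
  shows tops_in: "(x, tops F x) \<in> F"
    and tops_ge: "\<And>y. (x, y) \<in> F \<Longrightarrow> y \<le> tops F x"
proof -
  have fin: "finite {y. (x, y) \<in> F}"
    by (rule finite_subset[of _ "{..n}"]) (use F in \<open>auto simp: nu_face_def region_path\<close>)
  have "Max {y. (x, y) \<in> F} \<in> {y. (x, y) \<in> F}"
    using ex fin by (intro Max_in) auto
  then show "(x, tops F x) \<in> F" using x by (simp add: tops_def)
  show "y \<le> tops F x" if "(x, y) \<in> F" for y
    using that fin x by (simp add: tops_def)
qed

lemma nu_face_compatible:
  assumes "nu_face (path_of (rev s)) F" "(x, y) \<in> F" "(x', y') \<in> F" "x < x'" "x' \<le> S y"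
  shows "y' \<le> y"
proof (rule ccontr)
  assume "\<not> ?thesis"
  then have "incompatible (path_of (rev s)) (x, y) (x', y')"
    using assms by (simp add: incompatible_path)
  moreover have "(x, y) \<noteq> (x', y')" using assms by simp
  ultimately show False
    using assms(1-3) unfolding nu_face_def pairwise_def by blast
qed

text \<open>The bracket conditions express compatibility of the tops. If \<open>(x, y)\<close> is
  not a top, no later column within row \<open>y\<close> may have its top above this row, so
  \<open>x\<close> is the column forced by \<open>leftmost\<close>.\<close>

lemma
  assumes F: "nu_face (path_of (rev s)) F" and 0: "(0, n) \<in> F"
    and cols: "\<And>x. x \<le> W \<Longrightarrow> \<exists>y. (x, y) \<in> F"
  shows bracket_tops: "bracket (tops F)"
    and subset_tree_tops: "F \<subseteq> tree (tops F)"
proof -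
  have reg: "y \<le> n \<and> x \<le> S y" if "(x, y) \<in> F" for x y
    using F that by (auto simp: nu_face_def region_path)
  have t: "(x, tops F x) \<in> F" if "x \<le> W" for x
    using tops_in[OF F that cols[OF that]] .
  show br: "bracket (tops F)"
    unfolding bracket_def
  proof (intro conjI allI impI)
    show "tops F 0 = n"
      using tops_ge[OF F _ _ 0] 0 reg[OF t[of 0]] by fastforce
    show "tops F x \<le> n" "x \<le> S (tops F x)" if "x \<le> W" for x
      using reg[OF t[OF that]] by auto
    show "tops F x = 0" if "W < x" for x
      using that by (simp add: tops_def)
    fix x x' assume *: "x < x' \<and> x' \<le> S (tops F x)"
    then have "x' \<le> W" using S_le_W order_trans by blast
    then show "tops F x' \<le> tops F x"
      using nu_face_compatible[OF F t t, of x x'] * by simp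
  qed
  show "F \<subseteq> tree (tops F)"
  proof
    fix p assume p: "p \<in> F"
    obtain x y where xy: "p = (x, y)" by force
    have x: "x \<le> W" using reg p xy S_le_W order_trans by blast
    have le: "y \<le> tops F x" using tops_ge[OF F x] p xy by blast
    show "p \<in> tree (tops F)"
    proof (cases "y = tops F x")
      case False
      then have less: "y < tops F x" using le by simp
      then have yn: "y < n" using bracket_le[OF br, of x] by simp
      have "leftmost (tops F) y = x"
      proof (rule leftmost_eqI[OF br yn])
        show "x \<le> S y" using reg p xy by blast
        show "y < tops F x" by (rule less)
        fix z assume z: "z \<le> S y" "y < tops F z"
        then have "z \<le> W" using S_le_W order_trans by blast
        then have "\<not> x < z"
          using nu_face_compatible[OF F _ t, of x y z] p xy z by auto
        then show "z \<le> x" by simp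
      qed
      then show ?thesis using x xy yn by (simp add: tree_def)
    qed (use x xy in \<open>simp add: tree_def\<close>)
  qed
qed

text \<open>A larger face still meets every column and contains the top left corner, so it lies in
  the tree of its own tops, which has the same cardinality.\<close>

lemma nu_tree_tree:
  assumes h: "bracket h"
  shows "nu_tree (path_of (rev s)) (tree h)"
  unfolding nu_tree_def
proof (intro conjI allI impI)
  show "nu_face (path_of (rev s)) (tree h)" using h by (rule nu_face_tree)
  fix F assume F: "nu_face (path_of (rev s)) F \<and> tree h \<subseteq> F"
  have tops: "(x, h x) \<in> F" if "x \<le> W" for x
    using F top_in_tree[OF that] by blast
  then have "(0, n) \<in> F" using bracket_0[OF h] by (metis zero_le)
  moreover have "\<And>x. x \<le> W \<Longrightarrow> \<exists>y. (x, y) \<in> F" using tops by blast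
  ultimately have br: "bracket (tops F)" and sub: "F \<subseteq> tree (tops F)"
    using F bracket_tops[of F] subset_tree_tops[of F] by simp_all
  have "card (tree (tops F)) \<le> card (tree h)"
    using card_tree[OF br] card_tree[OF h] by simp
  then have "tree h = tree (tops F)"
    using F sub finite_tree[OF br] by (intro card_seteq) auto
  then show "F = tree h" using F sub by blast
qed

text \<open>A column \<open>x\<close> missed by a face can be filled at the lowest admissible height at which
  some column to the left of \<open>x\<close> has a point.\<close>

lemma nu_tree_cases:
  assumes F: "nu_tree (path_of (rev s)) F"
  obtains h where "bracket h" "F = tree h"
proof -
  have face: "nu_face (path_of (rev s)) F"
    using F by (simp add: nu_tree_def)
  have max: "p \<in> F" if "nu_face (path_of (rev s)) (insert p F)" for p
    using F that unfolding nu_tree_def by blast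
  have reg: "y \<le> n \<and> x \<le> S y" if "(x, y) \<in> F" for x y
    using face that by (auto simp: nu_face_def region_path)
  have ins: "(x, y) \<in> F"
    if "y \<le> n" "x \<le> S y"
      "\<And>x' y'. (x', y') \<in> F \<Longrightarrow> \<not> incompatible (path_of (rev s)) (x, y) (x', y')" for x y
  proof (rule max)
    have "\<not> incompatible (path_of (rev s)) (x', y') (x, y)" if "(x', y') \<in> F" for x' y'
      using \<open>(x', y') \<in> F\<close> \<open>\<And>x' y'. (x', y') \<in> F \<Longrightarrow> \<not> incompatible (path_of (rev s)) (x, y) (x', y')\<close>
      unfolding incompatible_path by metis
    then show "nu_face (path_of (rev s)) (insert (x, y) F)"
      using that face by (auto simp: nu_face_def region_path pairwise_insert)
  qed
  have 0: "(0, n) \<in> F"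
    by (rule ins) (use reg in \<open>auto simp: incompatible_path dest: leD\<close>)
  have cols: "\<exists>y. (x, y) \<in> F" if x: "x \<le> W" for x
  proof (cases "x = 0")
    case False
    define P where "P y \<longleftrightarrow> x \<le> S y \<and> (\<exists>x'<x. (x', y) \<in> F)" for y
    have "P n" using 0 x False by (auto simp: P_def)
    then obtain y where y: "P y" "\<And>z. P z \<Longrightarrow> y \<le> z"
      using LeastI[of P] Least_le[of P] by blast
    obtain x0 where x0: "x0 < x" "(x0, y) \<in> F" using y(1) by (auto simp: P_def)
    have "(x, y) \<in> F"
    proof (rule ins)
      show "y \<le> n" using reg[OF x0(2)] by simp
      show "x \<le> S y" using y(1) by (simp add: P_def)
      fix x' y' assume xy: "(x', y') \<in> F"
      have "y' \<le> y" if "x < x'" "x' \<le> S y"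
        using nu_face_compatible[OF face x0(2) xy] x0(1) that by simp
      moreover have "y \<le> y'" if "x' < x" "x \<le> S y'"
        using y(2)[of y'] that xy by (auto simp: P_def)
      ultimately show "\<not> incompatible (path_of (rev s)) (x, y) (x', y')"
        by (auto simp: incompatible_path)
    qed
    then show ?thesis by blast
  qed (use 0 in blast)
  have br: "bracket (tops F)" and sub: "F \<subseteq> tree (tops F)"
    using bracket_tops[OF face 0 cols] subset_tree_tops[OF face 0 cols] by simp_all
  have "tree (tops F) = F"
    using F sub nu_face_tree[OF br] unfolding nu_tree_def by blast
  then show thesis using that br by blast
qed

section \<open>Row counts determine the bracket function\<close>

lemma row_tree:
  assumes "bracket h"
  shows "{p \<in> tree h. snd p = i} =
    (\<lambda>x. (x, i)) ` {x. x \<le> W \<and> h x = i} \<union> (if i < n then {(leftmost h i, i)} else {})"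
  using assms by (auto simp: tree_def leftmost_le_W)

lemma card_row_tree:
  assumes "bracket h"
  shows "card {p \<in> tree h. snd p = i} = card {x. x \<le> W \<and> h x = i} + of_bool (i < n)"
proof -
  have fin: "finite {x. x \<le> W \<and> h x = i}" by simp
  show ?thesis
    unfolding row_tree[OF assms]
    using less_leftmost[OF assms, of i] fin
    by (auto simp: card_image inj_on_def image_iff)
qed

text \<open>The columns ending in row \<open>i\<close> are the rightmost ones among those that are still open.\<close>

lemma bracket_eq_of_card:
  assumes h: "bracket h" and k: "bracket k"
    and card: "\<And>i. card {x. x \<le> W \<and> h x = i} = card {x. x \<le> W \<and> k x = i}"
  shows "h = k"
proof (rule bracket_eqI[OF h k])
  have eq: "{x. x \<le> W \<and> h x = i} = {x. x \<le> W \<and> k x = i}" for i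
  proof (induction i rule: less_induct)
    case (less i)
    let ?V = "{x. x \<le> S i \<and> x \<le> W \<and> i \<le> h x}"
    have V: "?V = {x. x \<le> S i \<and> x \<le> W \<and> i \<le> k x}"
    proof -
      have "i \<le> h x \<longleftrightarrow> i \<le> k x" if "x \<le> W" for x
      proof -
        have "h x < i \<Longrightarrow> k x = h x" "k x < i \<Longrightarrow> h x = k x"
          using less.IH that by (auto simp: set_eq_iff)
        then show ?thesis by linarith
      qed
      then show ?thesis by blast
    qed
    have up: "{x. x \<le> W \<and> g x = i} \<subseteq> {x. x \<le> S i \<and> x \<le> W \<and> i \<le> g x}" if "bracket g" for g
      using bracket_below[OF that] by auto
    have cl: "y \<in> {x. x \<le> W \<and> g x = i}"
      if "bracket g" "x \<in> {x. x \<le> W \<and> g x = i}" "y \<in> {x. x \<le> S i \<and> x \<le> W \<and> i \<le> g x}" "x < y" for g x y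
      using bracket_nested[OF that(1), of x y] that by auto
    show ?case
    proof (rule upper_sets_eq)
      show "finite ?V" by simp
      show "{x. x \<le> W \<and> h x = i} \<subseteq> ?V" using up[OF h] .
      show "{x. x \<le> W \<and> k x = i} \<subseteq> ?V" unfolding V using up[OF k] .
      show "y \<in> {x. x \<le> W \<and> h x = i}" if "x \<in> {x. x \<le> W \<and> h x = i}" "y \<in> ?V" "x < y" for x y
        using cl[OF h] that by blast
      show "y \<in> {x. x \<le> W \<and> k x = i}" if "x \<in> {x. x \<le> W \<and> k x = i}" "y \<in> ?V" "x < y" for x y
        using cl[OF k] that unfolding V by blast
    qed (rule card)
  qed
  show "h x = k x" if "x \<le> W" for x
  proof -
    have "x \<in> {z. z \<le> W \<and> k z = h x}"
      using that by (subst eq[symmetric]) simp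
    then show ?thesis by simp
  qed
qed

section \<open>Covering faces\<close>

text \<open>The rows whose leftmost point can be removed without emptying the row.\<close>

definition ascent_rows :: "(nat \<Rightarrow> nat) \<Rightarrow> nat set" where
  "ascent_rows h = {i. i < n \<and> (\<exists>x\<le>W. h x = i)}"

text \<open>The column of the first point that remains in row \<open>i\<close> once the leftmost one
  has been removed.\<close>

definition first_col :: "(nat \<Rightarrow> nat) \<Rightarrow> nat \<Rightarrow> nat" where
  "first_col h i = (LEAST x. x \<le> W \<and> h x = i)"

lemma
  assumes "i \<in> ascent_rows h"
  shows first_col_le_W: "first_col h i \<le> W"
    and height_first_col: "h (first_col h i) = i"
    and first_col_le: "\<And>x. x \<le> W \<Longrightarrow> h x = i \<Longrightarrow> first_col h i \<le> x"
proof -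
  obtain x where "x \<le> W \<and> h x = i" using assms by (auto simp: ascent_rows_def)
  then have "first_col h i \<le> W \<and> h (first_col h i) = i"
    unfolding first_col_def by (rule LeastI)
  then show "first_col h i \<le> W" "h (first_col h i) = i" by auto
  show "first_col h i \<le> x" if "x \<le> W" "h x = i" for x
    unfolding first_col_def using that by (intro Least_le) auto
qed

lemma first_col_pos: "bracket h \<Longrightarrow> i \<in> ascent_rows h \<Longrightarrow> 0 < first_col h i"
  using height_first_col[of i h] by (cases "first_col h i") (auto simp: ascent_rows_def bracket_0)

lemma first_col_le_S: "bracket h \<Longrightarrow> i \<in> ascent_rows h \<Longrightarrow> first_col h i \<le> S i"
  using height_first_col first_col_le_W bracket_below by metis

definition face :: "(nat \<Rightarrow> nat) \<Rightarrow> nat set \<Rightarrow> point set" where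
  "face h A = tree h - (\<lambda>i. (leftmost h i, i)) ` A"

text \<open>For \<open>i \<le> n\<close> and \<open>A \<subseteq> ascent_rows h\<close>, the column
  of the leftmost point of \<open>face h A\<close> in row \<open>i\<close>.\<close>

definition face_left :: "(nat \<Rightarrow> nat) \<Rightarrow> nat set \<Rightarrow> nat \<Rightarrow> nat" where
  "face_left h A i = (if i = n then 0 else if i \<in> A then first_col h i else leftmost h i)"

text \<open>\<open>raise h A\<close> is the bracket function of the largest tree containing \<open>face h A\<close>: column \<open>x\<close>
  must stop at the first row in which the face has a point to the left of \<open>x\<close>.\<close>

definition raise :: "(nat \<Rightarrow> nat) \<Rightarrow> nat set \<Rightarrow> nat \<Rightarrow> nat" where
  "raise h A x =
     (if x = 0 then n else if x \<le> W then LEAST i. x \<le> S i \<and> face_left h A i < x else 0)"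

lemma
  assumes "0 < x" "x \<le> W"
  shows raise_below: "x \<le> S (raise h A x)"
    and face_left_raise: "face_left h A (raise h A x) < x"
    and raise_le: "\<And>i. x \<le> S i \<Longrightarrow> face_left h A i < x \<Longrightarrow> raise h A x \<le> i"
proof -
  have eq: "raise h A x = (LEAST i. x \<le> S i \<and> face_left h A i < x)"
    using assms by (simp add: raise_def)
  have "x \<le> S n \<and> face_left h A n < x" using assms by (simp add: face_left_def)
  then have "x \<le> S (raise h A x) \<and> face_left h A (raise h A x) < x"
    unfolding eq by (rule LeastI)
  then show "x \<le> S (raise h A x)" "face_left h A (raise h A x) < x" by auto
  show "raise h A x \<le> i" if "x \<le> S i" "face_left h A i < x" for i
    unfolding eq using that by (intro Least_le) auto
qed

text \<open>The row in which column \<open>x\<close> stops has a face point left of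
  \<open>x\<close>. This point is also left of every later column, which therefore cannot pass above
  this row either if it lies within it.\<close>

lemma bracket_raise: "bracket (raise h A)"
  unfolding bracket_def
proof (intro conjI allI impI)
  have le: "raise h A x \<le> n" for x
    using raise_le[of x n h A] by (cases "x = 0 \<or> \<not> x \<le> W") (auto simp: raise_def face_left_def)
  show "raise h A 0 = n" by (simp add: raise_def)
  show "raise h A x \<le> n" for x by (rule le)
  show "x \<le> S (raise h A x)" if "x \<le> W" for x
    using raise_below[of x] that by (cases "x = 0") auto
  show "raise h A x = 0" if "W < x" for x using that by (simp add: raise_def)
  fix x x' assume *: "x < x' \<and> x' \<le> S (raise h A x)"
  then have "x' \<le> W" using S_le_W order_trans by blast
  then show "raise h A x' \<le> raise h A x"
    using * le[of x'] raise_le[of x' "raise h A x" h A] face_left_raise[of x h A]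
    by (cases "x = 0") (auto simp: raise_def)
qed

lemma le_face_left:
  assumes "x \<le> S i" "i < raise h A x"
  shows "x \<le> face_left h A i"
  using raise_le[of x i h A] assms S_le_W[of i] by (cases "x = 0") force+



lemma tops_subset_face:
  assumes "bracket h" "A \<subseteq> ascent_rows h" "x \<le> W"
  shows "(x, h x) \<in> face h A"
proof -
  have "(x, h x) \<noteq> (leftmost h i, i)" if "i \<in> A" for i
    using that assms less_leftmost[of h i] by (auto simp: ascent_rows_def)
  then show ?thesis using assms(3) by (auto simp: face_def top_in_tree)
qed

lemma face_left_in_face:
  assumes h: "bracket h" and A: "A \<subseteq> ascent_rows h" and i: "i \<le> n"
  shows "(face_left h A i, i) \<in> face h A"
proof -
  consider "i = n" | "i < n" "i \<in> A" | "i < n" "i \<notin> A" using i by linarith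
  then show ?thesis
  proof cases
    case 1
    then show ?thesis using tops_subset_face[OF h A, of 0] bracket_0[OF h] by (simp add: face_left_def)
  next
    case 2
    then have "i \<in> ascent_rows h" using A by blast
    then show ?thesis
      using 2 tops_subset_face[OF h A first_col_le_W[of i h]] height_first_col[of i h]
      by (simp add: face_left_def)
  next
    case 3
    then show ?thesis using leftmost_in_tree[OF h, of i] by (auto simp: face_left_def face_def)
  qed
qed

lemma face_cases:
  assumes "bracket h" "(x, i) \<in> face h A"
  obtains "x \<le> W" "i = h x" | "i < n" "i \<notin> A" "x = leftmost h i"
  using assms by (auto simp: face_def tree_def)

text \<open>The leftmost point of the tree lies strictly to the left of every top in its row. If the
  face has no point before the top \<open>x\<close>, this leftmost point must have been
  removed.\<close>

lemma face_left_top: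
  assumes h: "bracket h" and A: "A \<subseteq> ascent_rows h"
    and x: "x \<le> W" "h x = i" "i < n" "x \<le> face_left h A i"
  shows "i \<in> A" "x = first_col h i" "face_left h A i = x"
proof -
  show i: "i \<in> A"
  proof (rule ccontr)
    assume "i \<notin> A"
    then have "face_left h A i = leftmost h i" using x(3) by (simp add: face_left_def)
    then show False using leftmost_less[OF h x(1-3)] x(4) by simp
  qed
  show "x = first_col h i"
    using first_col_le[of i h x] i A x by (auto simp: face_left_def)
  then show "face_left h A i = x" using i x(3) by (simp add: face_left_def)
qed

text \<open>The tops of the face bound \<open>k\<close> from below, and the face point in row
  \<open>raise h A x\<close> to the left of \<open>x\<close> bounds the height of column
  \<open>x\<close> from above. Conversely, under these bounds no column of \<open>k\<close> beyond
  \<open>face_left h A i\<close> and within row \<open>i\<close> passes above row \<open>i\<close>,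
  so every face point is a top or a leftmost point of \<open>tree k\<close>.\<close>

lemma face_subset_tree_iff:
  assumes h: "bracket h" and A: "A \<subseteq> ascent_rows h" and k: "bracket k"
  shows "face h A \<subseteq> tree k \<longleftrightarrow> h \<le> k \<and> k \<le> raise h A"
proof
  assume sub: "face h A \<subseteq> tree k"
  have "h x \<le> k x" for x
    using tops_subset_face[OF h A, of x] sub tree_le_top[OF k] bracket_outside[OF h, of x]
    by (cases "x \<le> W") auto
  moreover have "k x \<le> raise h A x" for x
  proof -
    consider "x = 0" | "W < x" | "0 < x" "x \<le> W" by linarith
    then show ?thesis
    proof cases
      case 3
      let ?u = "raise h A x"
      have "(face_left h A ?u, ?u) \<in> tree k"
        using face_left_in_face[OF h A] sub bracket_le[OF bracket_raise] by blast
      then show ?thesis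
        using tree_compatible[OF k _ top_in_tree[of x k]] face_left_raise[of x h A]
          raise_below[of x h A] 3 by blast
    qed (use k in \<open>auto simp: raise_def bracket_0 bracket_outside\<close>)
  qed
  ultimately show "h \<le> k \<and> k \<le> raise h A" by (simp add: le_fun_def)
next
  assume "h \<le> k \<and> k \<le> raise h A"
  then have hk: "h x \<le> k x" and ku: "k x \<le> raise h A x" for x by (auto simp: le_fun_def)
  have left: "z \<le> face_left h A i" if "z \<le> S i" "i < k z" for z i
    using le_face_left[OF that(1)] ku[of z] that(2) by simp
  show "face h A \<subseteq> tree k"
  proof (rule subrelI)
    fix x i assume "(x, i) \<in> face h A"
    with h show "(x, i) \<in> tree k"
    proof (cases rule: face_cases)
      case 1
      show ?thesis
      proof (cases "k x = h x")
        case True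
        then show ?thesis using 1 by (simp add: tree_def)
      next
        case False
        then have less: "i < k x" using hk[of x] 1 by simp
        then have i: "i < n" using bracket_le[OF k, of x] by simp
        have xi: "x \<le> S i" using bracket_below[OF h] 1 by simp
        \<comment> \<open>Since \<open>k\<close> raises this top, the column now passes above row
          \<open>i\<close>. By \<open>left\<close> it cannot lie after the first face point of the
          row, so it is that point and becomes the leftmost one of \<open>tree k\<close>.\<close>
        have "face_left h A i = x"
          using face_left_top(3)[OF h A] 1 i left[OF xi less] by blast
        then have "leftmost k i = x"
          using left by (intro leftmost_eqI[OF k i xi less]) metis
        then show ?thesis using 1 i by (simp add: tree_def)
      qed
    next
      case 2
      then have "face_left h A i = x" by (simp add: face_left_def)
      moreover have "x \<le> S i" "i < h x" using 2 leftmost_le[OF h] less_leftmost[OF h] by auto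
      ultimately have "leftmost k i = x"
        using left hk[of x] 2 by (intro leftmost_eqI[OF k]) (auto, metis)
      then show ?thesis using 2 leftmost_in_tree[OF k, of i] by simp
    qed
  qed
qed

lemma face_subset_tree: "face h A \<subseteq> tree h"
  by (auto simp: face_def)

lemma le_raise:
  assumes "bracket h" "A \<subseteq> ascent_rows h"
  shows "h \<le> raise h A"
  using face_subset_tree_iff[OF assms assms(1)] face_subset_tree by simp

lemma face_subset_tree_raise:
  assumes "bracket h" "A \<subseteq> ascent_rows h"
  shows "face h A \<subseteq> tree (raise h A)"
  using face_subset_tree_iff[OF assms bracket_raise] le_raise[OF assms] by simp

text \<open>In row \<open>i\<close> the face begins with column \<open>first_col h i\<close> itself,
  and a column is stopped only by a point strictly to its left.\<close>

lemma raise_first_col_greater: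
  assumes h: "bracket h" and A: "A \<subseteq> ascent_rows h" and i: "i \<in> A"
  shows "i < raise h A (first_col h i)"
proof -
  have i': "i \<in> ascent_rows h" using A i by blast
  have "i \<le> raise h A (first_col h i)"
    using le_raise[OF h A] height_first_col[OF i'] by (metis le_fun_def)
  moreover have "raise h A (first_col h i) \<noteq> i"
    using face_left_raise[OF first_col_pos[OF h i'] first_col_le_W[OF i'], of h A] i i'
    by (auto simp: face_left_def ascent_rows_def)
  ultimately show ?thesis by simp
qed

text \<open>In the raised tree the column \<open>first_col h i\<close> passes above row
  \<open>i\<close>, so the leftmost point of this row has moved strictly to the right of the removed
  one.\<close>

lemma tree_Int_tree_raise:
  assumes h: "bracket h" and A: "A \<subseteq> ascent_rows h"
  shows "tree h \<inter> tree (raise h A) = face h A"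
proof (rule antisym)
  show "face h A \<subseteq> tree h \<inter> tree (raise h A)"
    using face_subset_tree face_subset_tree_raise[OF h A] by blast
  have "(leftmost h i, i) \<notin> tree (raise h A)" if i: "i \<in> A" for i
  proof
    have i': "i \<in> ascent_rows h" "i < n" using A i by (auto simp: ascent_rows_def)
    assume "(leftmost h i, i) \<in> tree (raise h A)"
    moreover have "i < raise h A (leftmost h i)"
      using less_leftmost[OF h i'(2)] le_raise[OF h A] by (metis le_fun_def order_less_le_trans)
    ultimately have "leftmost h i = leftmost (raise h A) i" by (auto simp: tree_def)
    moreover have "first_col h i \<le> leftmost (raise h A) i"
      using leftmost_ge[OF bracket_raise i'(2) first_col_le_S[OF h i'(1)]]
        raise_first_col_greater[OF h A i] by blast
    moreover have "leftmost h i < first_col h i"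
      using leftmost_less[OF h first_col_le_W[OF i'(1)] height_first_col[OF i'(1)] i'(2)] .
    ultimately show False by simp
  qed
  then show "tree h \<inter> tree (raise h A) \<subseteq> face h A" by (auto simp: face_def)
qed

lemma asso_nu_face:
  assumes h: "bracket h" and A: "A \<subseteq> ascent_rows h"
  shows "face h A \<in> asso_nu (path_of (rev s))"
proof -
  have "nu_face (path_of (rev s)) (face h A)"
    using nu_face_tree[OF h] face_subset_tree
    unfolding nu_face_def by (meson order_trans pairwise_subset)
  moreover have "\<exists>x. (x, i) \<in> face h A" if "i \<le> n" for i
    using face_left_in_face[OF h A that] by blast
  moreover have "\<exists>y. (x, y) \<in> face h A" if "x \<le> W" for x
    using tops_subset_face[OF h A that] by blast
  moreover have "(0, n) \<in> face h A"
    using tops_subset_face[OF h A, of 0] bracket_0[OF h] by simp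
  moreover have "W = sum_list (rev s)" by (simp add: S_def)
  ultimately show ?thesis
    by (simp add: asso_nu_def covering_def path_height_path_of path_width_path_of)
qed

text \<open>The tops of the face give \<open>h\<close>, and \<open>A\<close> collects the rows whose
  leftmost point is missing. Since the face meets such a row, it has a column top there, which makes
  it an ascent row.\<close>

lemma asso_nu_cases:
  assumes F: "F \<in> asso_nu (path_of (rev s))"
  obtains h A where "bracket h" "A \<subseteq> ascent_rows h" "F = face h A"
proof -
  have "W = sum_list (rev s)" by (simp add: S_def)
  then have face: "nu_face (path_of (rev s)) F" and 0: "(0, n) \<in> F"
    and rows: "\<And>y. y \<le> n \<Longrightarrow> \<exists>x. (x, y) \<in> F" and cols: "\<And>x. x \<le> W \<Longrightarrow> \<exists>y. (x, y) \<in> F"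
    using F by (auto simp: asso_nu_def covering_def path_height_path_of path_width_path_of)
  define h where "h = tops F"
  have h: "bracket h" and sub: "F \<subseteq> tree h"
    using bracket_tops[OF face 0 cols] subset_tree_tops[OF face 0 cols] by (simp_all add: h_def)
  define A where "A = {i. i < n \<and> (leftmost h i, i) \<notin> F}"
  have top: "(x, h x) \<in> F" if "x \<le> W" for x
    using tops_in[OF face that cols[OF that]] by (simp add: h_def)
  have "i \<in> ascent_rows h" if i: "i \<in> A" for i
  proof -
    obtain x where x: "(x, i) \<in> F" using rows[of i] i by (auto simp: A_def)
    then have "x \<le> W" "i = h x \<or> x = leftmost h i" using sub by (auto simp: tree_def)
    then show ?thesis using x i by (auto simp: A_def ascent_rows_def)
  qed
  moreover have "F = face h A"
  proof
    show "F \<subseteq> face h A" using sub by (auto simp: face_def A_def)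
    show "face h A \<subseteq> F"
    proof (rule subrelI)
      fix x i assume "(x, i) \<in> face h A"
      with h show "(x, i) \<in> F" by (cases rule: face_cases) (auto simp: top A_def)
    qed
  qed
  ultimately show thesis using that h by blast
qed

lemma nu_rotation_raise:
  assumes h: "bracket h" and i: "i \<in> ascent_rows h"
  shows "nu_rotation (tree h) (leftmost h i, i) (tree (raise h {i}))"
proof -
  let ?l = "leftmost h i" and ?x = "first_col h i" and ?F = "tree h" and ?F' = "tree (raise h {i})"
  have A: "{i} \<subseteq> ascent_rows h" and i_n: "i < n" using i by (auto simp: ascent_rows_def)
  note h' = bracket_raise[of h "{i}"]
  \<comment> \<open>The corners of the rectangle are the next point above the ascent in its column,
    at height \<open>j\<close>, and the first top in row \<open>i\<close>.\<close>
  define P where "P j \<longleftrightarrow> i < j \<and> (?l, j) \<in> ?F" for j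
  have "P (h ?l)"
    using less_leftmost[OF h i_n] top_in_tree[OF leftmost_le_W[OF h i_n]] by (simp add: P_def)
  then obtain j where j: "P j" and j_min: "\<And>k. P k \<Longrightarrow> j \<le> k"
    using LeastI[of P] Least_le[of P] by blast
  have ij: "i < j" and jF: "(?l, j) \<in> ?F" using j by (auto simp: P_def)
  have jn: "j \<le> n" using tree_le_n[OF h jF] .
  have x: "?x \<le> W" "h ?x = i" "?x \<le> S i" "?l < ?x"
    using first_col_le_W[OF i] height_first_col[OF i] first_col_le_S[OF h i]
      leftmost_less[OF h _ _ i_n] by auto
  have xF: "(?x, i) \<in> ?F" using top_in_tree[OF x(1), of h] x(2) by simp
  have qF: "(?l, i) \<in> ?F" using leftmost_in_tree[OF h i_n] .
  have Int: "?F \<inter> ?F' = ?F - {(?l, i)}"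
    using tree_Int_tree_raise[OF h A] by (simp add: face_def)
  define k where "k = raise h {i} ?x"
  have ik: "i < k" using raise_first_col_greater[OF h A] by (simp add: k_def)
  have new: "(?x, k) \<in> ?F'" using top_in_tree[OF x(1)] by (simp add: k_def)
  have newF: "(?x, k) \<notin> ?F" using tree_le_top[OF h, of ?x k] x(2) ik by auto
  \<comment> \<open>Both trees have the same size and share all points but the ascent, so exhibiting
    one new point determines the raised tree.\<close>
  have "card (insert (?x, k) (?F - {(?l, i)})) = card ?F'"
    using newF qF finite_tree[OF h] card_tree[OF h] card_tree[OF h'] by simp
  moreover have "insert (?x, k) (?F - {(?l, i)}) \<subseteq> ?F'" using new Int by blast
  ultimately have F': "?F' = (?F - {(?l, i)}) \<union> {(?x, k)}"
    using card_subset_eq[OF finite_tree[OF h']] by (metis Un_insert_right sup_bot_right)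
  have "(?l, j) \<in> ?F'" using jF ij F' by auto
  moreover have "?x \<le> S j" using x(3) S_mono[of i j] ij by linarith
  ultimately have "k \<le> j" using tree_compatible[OF h' _ new] x(4) by blast
  \<comment> \<open>Otherwise the leftmost point of row \<open>k\<close> in the raised tree is an
    old point before \<open>?x\<close>. Before \<open>?l\<close> it would be incompatible with
    \<open>(?l, j)\<close>, in \<open>?l\<close> it contradicts the choice of \<open>j\<close>, and
    after \<open>?l\<close> the maximality of \<open>?l\<close> in row \<open>i\<close>.\<close>
  moreover have "\<not> k < j"
  proof
    assume less: "k < j"
    define z where "z = leftmost (raise h {i}) k"
    have kn: "k < n" using less jn by simp
    have zx: "z < ?x" unfolding z_def using leftmost_less[OF h' x(1) _ kn] by (simp add: k_def)
    have "(z, k) \<in> ?F'" using leftmost_in_tree[OF h' kn] by (simp add: z_def)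
    then have zF: "(z, k) \<in> ?F" using F' zx by auto
    have "\<not> z < ?l"
      using tree_compatible[OF h zF jF] less leftmost_le[OF h i_n] S_mono[of i k] ik by auto
    moreover have "z \<noteq> ?l" using j_min[of k] zF ik less by (auto simp: P_def)
    moreover have "\<not> ?l < z"
      using leftmost_ge[OF h i_n, of z] zx x(3) tree_le_top[OF h zF] ik by auto
    ultimately show False by simp
  qed
  ultimately have kj: "k = j" by simp
  have "?F \<inter> rect (?l, j) (?x, i) \<subseteq> {(?l, j), (?l, i), (?x, i)}"
  proof (rule subrelI)
    fix z m assume "(z, m) \<in> ?F \<inter> rect (?l, j) (?x, i)"
    then have zF: "(z, m) \<in> ?F" and z: "?l \<le> z" "z \<le> ?x" and m: "i \<le> m" "m \<le> j"
      using x(4) ij by (auto simp: rect_def)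
    show "(z, m) \<in> {(?l, j), (?l, i), (?x, i)}"
    proof (cases "z = ?l")
      case True
      then show ?thesis using j_min[of m] m zF by (auto simp: P_def)
    next
      case False
      then have "\<not> i < h z" using leftmost_ge[OF h i_n, of z] z x(3) by auto
      then have "h z = i" "m = i" using tree_le_top[OF h zF] m by auto
      then show ?thesis using first_col_le[OF i, of z] z x(1) by auto
    qed
  qed
  then show ?thesis
    unfolding nu_rotation_def F' kj
    using jF xF qF ij x(4)
    by (intro bexI[of _ "(?l, j)"] bexI[of _ "(?x, i)"])
      (auto simp: sw_corner_def ne_corner_def)
qed

end

text \<open>The difference \<open>F - F'\<close> recovers the ascent, since the new corner differs
  from it.\<close>

lemma nu_rotation_unique:
  assumes "nu_rotation F q F'" "nu_rotation F r F'"
  shows "q = r"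
proof -
  have "F - F' = {q}" if "nu_rotation F q F'" for q
    using that by (auto simp: nu_rotation_def sw_corner_def ne_corner_def min_def max_def
        split: if_splits)
  then show ?thesis using assms by blast
qed

section \<open>Trees in reverse preorder\<close>

lemma subtrees_self: "t \<in> subtrees t"
  by (cases t) auto

lemma subtrees_trans: "u \<in> subtrees t \<Longrightarrow> v \<in> subtrees u \<Longrightarrow> v \<in> subtrees t"
  by (induction t rule: subtrees.induct) auto

lemma set_labels_subtree: "u \<in> subtrees t \<Longrightarrow> set (labels u) \<subseteq> set (labels t)"
  by (induction t rule: subtrees.induct) auto

lemma subtrees_child: "Node c ts \<in> subtrees T \<Longrightarrow> t \<in> set ts \<Longrightarrow> t \<in> subtrees T"
  using subtrees_trans[of "Node c ts" T t] subtrees_self[of t] by auto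

lemma mem_labels_iff: "a \<in> set (labels t) \<longleftrightarrow> (\<exists>ts. Node a ts \<in> subtrees t)"
proof
  show "a \<in> set (labels t) \<Longrightarrow> \<exists>ts. Node a ts \<in> subtrees t"
    by (induction t rule: labels.induct) (auto, blast)
  show "\<exists>ts. Node a ts \<in> subtrees t \<Longrightarrow> a \<in> set (labels t)"
    using set_labels_subtree by fastforce
qed

lemma distinct_concat_nth_disjoint:
  assumes "distinct (concat xss)" "i < length xss" "j < length xss" "i \<noteq> j"
  shows "set (xss ! i) \<inter> set (xss ! j) = {}"
proof -
  have *: "set (xss ! i) \<inter> set (xss ! j) = {}" if "i < j" "j < length xss" for i j
  proof -
    have "concat xss = concat (take j xss) @ xss ! j @ concat (drop (Suc j) xss)"
      using id_take_nth_drop[OF that(2)] by (metis concat.simps(2) concat_append)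
    moreover have "xss ! i \<in> set (take j xss)"
      using that by (metis in_set_conv_nth length_take min.absorb4 nth_take)
    ultimately show ?thesis using assms(1) by auto
  qed
  show ?thesis using *[of i j] *[of j i] assms by (cases "i < j") auto
qed

lemma distinct_concatD: "distinct (concat xss) \<Longrightarrow> xs \<in> set xss \<Longrightarrow> distinct xs"
  by (induction xss) auto

lemma children_disjoint:
  assumes "distinct (concat (map labels ts))" "i < length ts" "j < length ts"
    "a \<in> set (labels (ts ! i))" "a \<in> set (labels (ts ! j))"
  shows "i = j"
  using distinct_concat_nth_disjoint[OF assms(1), of i j] assms(2-) by auto

lemma node_unique:
  assumes "distinct (labels T)" "Node c ts \<in> subtrees T" "Node c us \<in> subtrees T"
  shows "ts = us"
  using assms
proof (induction T rule: subtrees.induct)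
  case (2 y vs)
  have dis: "distinct (concat (map labels vs))" "y \<notin> set (concat (map labels vs))"
    using "2.prems"(1) by auto
  have in_labels: "c \<in> set (labels v)" if "Node c ws \<in> subtrees v" for ws v
    using that mem_labels_iff by blast
  consider "c = y" | t u where "t \<in> set vs" "Node c ts \<in> subtrees t" "u \<in> set vs" "Node c us \<in> subtrees u"
    using "2.prems"(2,3) by auto
  then show ?case
  proof cases
    case 1
    then have "\<not> Node c ws \<in> subtrees v" if "v \<in> set vs" for v ws
      using dis(2) in_labels that by auto
    then show ?thesis using "2.prems"(2,3) by auto
  next
    case tu: 2
    obtain i j where ij: "i < length vs" "t = vs ! i" "j < length vs" "u = vs ! j"
      using tu by (auto simp: in_set_conv_nth)
    have "i = j"
      by (rule children_disjoint[OF dis(1), of i j c]) (use ij tu in_labels in auto)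
    then have "t = u" using ij by simp
    moreover have "distinct (labels t)" using distinct_concatD[OF dis(1)] tu(1) by auto
    ultimately show ?thesis using "2.IH"[of t] tu by blast
  qed
qed simp

lemma distinct_children:
  assumes "distinct (labels T)" "Node c ts \<in> subtrees T"
  shows "distinct (concat (map labels ts))"
proof -
  have "distinct (labels u)" if "u \<in> subtrees T" for u
    using assms(1) that
  proof (induction T rule: subtrees.induct)
    case (2 y vs)
    then show ?case using distinct_concatD[of "map labels vs"] by auto
  qed simp
  then have "distinct (labels (Node c ts))" using assms(2) .
  then show ?thesis by simp
qed

lemma in_child_inj:
  assumes "distinct (labels T)" "in_child T c i a" "in_child T c j a"
  shows "i = j"
  using assms node_unique[OF assms(1)] children_disjoint[OF distinct_children[OF assms(1)]]
  unfolding in_child_def by blast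

lemma in_child_trans:
  assumes "in_child T y i c" "in_child T c j a" "distinct (labels T)"
  shows "in_child T y i a"
proof -
  obtain ts where ts: "Node y ts \<in> subtrees T" "i < length ts" "c \<in> set (labels (ts ! i))"
    using assms(1) by (auto simp: in_child_def)
  obtain us where us: "Node c us \<in> subtrees T" "j < length us" "a \<in> set (labels (us ! j))"
    using assms(2) by (auto simp: in_child_def)
  obtain vs where vs: "Node c vs \<in> subtrees (ts ! i)" using ts(3) by (auto simp: mem_labels_iff)
  then have "Node c vs \<in> subtrees T"
    using subtrees_trans subtrees_child[OF ts(1)] ts(2) nth_mem by blast
  then have "vs = us" using node_unique[OF assms(3)] us(1) by blast
  then have "set (labels (us ! j)) \<subseteq> set (labels (ts ! i))"
    using set_labels_subtree[OF vs] nth_mem[OF us(2)] by auto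
  then show ?thesis using ts us by (auto simp: in_child_def)
qed

lemma card_inv_child:
  assumes dis: "distinct (labels T)" and a: "in_child T c i a"
  shows "card_inv s T c a = i"
proof -
  have "\<not> left_of T a c" "\<not> left_of T c a"
    using in_child_inj[OF dis] in_child_trans[OF _ a dis] unfolding left_of_def
    by (metis less_irrefl)+
  moreover have "in_child T c j a \<longleftrightarrow> j = i" for j
    using in_child_inj[OF dis a] a by blast
  ultimately show ?thesis by (auto simp: card_inv_def)
qed

text \<open>Descend from the root to the first node that is one of the two labels or has them in
  different children.\<close>

lemma related_cases:
  assumes "a \<in> set (labels T)" "c \<in> set (labels T)" "a \<noteq> c"
  shows "(\<exists>i. in_child T c i a) \<or> (\<exists>i. in_child T a i c) \<or> left_of T a c \<or> left_of T c a"
  using assms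
proof (induction T rule: labels.induct)
  case (2 y ts)
  have child: "in_child (Node y ts) y i b" if "i < length ts" "b \<in> set (labels (ts ! i))" for i b
    using that by (auto simp: in_child_def)
  have mono: "in_child (Node y ts) b j d" if "in_child t b j d" "t \<in> set ts" for t b j d
    using that by (auto simp: in_child_def)
  have mono_left: "left_of (Node y ts) b d" if "left_of t b d" "t \<in> set ts" for t b d
    using that mono unfolding left_of_def by blast
  have cases: "b = y \<or> (\<exists>i<length ts. b \<in> set (labels (ts ! i)))" if "b \<in> set (labels (Node y ts))" for b
  proof -
    have "b = y \<or> (\<exists>t\<in>set ts. b \<in> set (labels t))" using that by auto
    then show ?thesis by (metis in_set_conv_nth)
  qed
  consider "a = y" | "c = y"
    | i j where "i < length ts" "a \<in> set (labels (ts ! i))" "j < length ts" "c \<in> set (labels (ts ! j))"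
    using cases "2.prems" by blast
  then show ?case
  proof cases
    case 1
    then show ?thesis using cases[OF "2.prems"(2)] "2.prems"(3) child by blast
  next
    case 2
    then show ?thesis using cases[OF "2.prems"(1)] "2.prems"(3) child by blast
  next
    case 3
    show ?thesis
    proof (cases "i = j")
      case True
      then show ?thesis
        using "2.IH"[of "ts ! i"] 3 \<open>a \<noteq> c\<close> mono[of "ts ! i"] mono_left[of "ts ! i"] nth_mem by meson
    next
      case False
      then have "left_of (Node y ts) a c \<or> left_of (Node y ts) c a"
        using child[OF 3(1,2)] child[OF 3(3,4)] unfolding left_of_def by (meson linorder_neqE_nat)
      then show ?thesis by blast
    qed
  qed
qed simp

section \<open>Internal labels in reverse preorder\<close>

fun revlabels :: "stree \<Rightarrow> nat list" where
  "revlabels Leaf = []"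
| "revlabels (Node y ts) = y # concat (map revlabels (rev ts))"

lemma mset_revlabels: "mset (revlabels t) = mset (labels t)"
proof (induction t rule: labels.induct)
  case (2 y ts)
  have "mset (concat (map revlabels (rev ts))) = (\<Sum>t\<leftarrow>rev ts. mset (revlabels t))"
    by (simp add: mset_concat comp_def)
  also have "\<dots> = (\<Sum>t\<leftarrow>ts. mset (revlabels t))"
    by (metis rev_map sum_list_rev)
  also have "\<dots> = (\<Sum>t\<leftarrow>ts. mset (labels t))"
    using "2.IH" by (metis (mono_tags, lifting) map_eq_conv)
  also have "\<dots> = mset (concat (map labels ts))"
    by (simp add: mset_concat comp_def)
  finally show ?case by simp
qed simp

lemma set_revlabels: "set (revlabels t) = set (labels t)"
  using mset_revlabels by (metis set_mset_mset)

lemma distinct_revlabels: "distinct (revlabels t) = distinct (labels t)"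
  using mset_revlabels by (metis mset_eq_imp_distinct_iff)

lemma sorted_wrt_concat:
  assumes "\<And>xs. xs \<in> set xss \<Longrightarrow> sorted_wrt P xs"
    and "sorted_wrt (\<lambda>xs ys. \<forall>x\<in>set xs. \<forall>y\<in>set ys. P x y) xss"
  shows "sorted_wrt P (concat xss)"
  using assms by (induction xss) (auto simp: sorted_wrt_append)

text \<open>In a Tamari tree the children of \<open>c\<close> carry, from left to right, larger and larger labels:
  a pair \<open>b < a\<close> with \<open>a\<close> further left would violate the Tamari condition.\<close>

lemma tamari_children_less:
  assumes T: "tamari_tree s T" and ij: "i < j" and a: "in_child T c i a" and b: "in_child T c j b"
  shows "a < b"
proof (rule ccontr)
  assume "\<not> a < b"
  have dec: "decreasing_tree s T" using T by (simp add: tamari_tree_def)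
  have dis: "distinct (labels T)" using dec by (simp add: decreasing_tree_def)
  have "a \<noteq> b" using in_child_inj[OF dis a] b ij by auto
  then have ba: "b < a" using \<open>\<not> a < b\<close> by simp
  obtain ts where ts: "Node c ts \<in> subtrees T" "i < length ts" "a \<in> set (labels (ts ! i))"
    using a by (auto simp: in_child_def)
  have "a < c" using dec ts nth_mem unfolding decreasing_tree_def by blast
  moreover have "c \<in> set (labels T)" using ts(1) mem_labels_iff by blast
  moreover have "b \<in> set (labels T)"
    using b set_labels_subtree subtrees_child nth_mem unfolding in_child_def by blast
  ultimately have "card_inv s T c b \<le> card_inv s T c a"
    using T ba dec by (auto simp: tamari_tree_def decreasing_tree_def)
  then show False using card_inv_child[OF dis a] card_inv_child[OF dis b] ij by simp
qed

text \<open>The labels below a node increase from one child to the next, so visiting the children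
  from right to left reads them in decreasing order.\<close>

lemma tamari_revlabels:
  assumes T: "tamari_tree s T"
  shows "revlabels T = rev [1..<Suc (length s)]"
proof -
  have dec: "decreasing_tree s T" using T by (simp add: tamari_tree_def)
  have "sorted_wrt (>) (revlabels t)" if "t \<in> subtrees T" for t
    using that
  proof (induction t rule: labels.induct)
    case (2 c ts)
    have "sorted_wrt (>) (concat (map revlabels (rev ts)))"
    proof (rule sorted_wrt_concat)
      fix xs assume "xs \<in> set (map revlabels (rev ts))"
      then show "sorted_wrt (>) xs" using "2.IH" subtrees_child[OF "2.prems"] by auto
    next
      have "sorted_wrt (\<lambda>u t. \<forall>x\<in>set (labels t). \<forall>y\<in>set (labels u). x > y) ts"
        unfolding sorted_wrt_iff_nth_less
      proof (intro allI impI ballI)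
        fix i j x y
        assume "i < j" "j < length ts" "x \<in> set (labels (ts ! j))" "y \<in> set (labels (ts ! i))"
        then have "in_child T c i y" "in_child T c j x"
          using "2.prems" order_less_trans unfolding in_child_def by blast+
        then show "y < x" using tamari_children_less[OF T \<open>i < j\<close>] by blast
      qed
      then show "sorted_wrt (\<lambda>xs ys. \<forall>x\<in>set xs. \<forall>y\<in>set ys. x > y) (map revlabels (rev ts))"
        by (simp add: sorted_wrt_map sorted_wrt_rev set_revlabels)
    qed
    moreover have "\<forall>t\<in>set ts. \<forall>a\<in>set (labels t). a < c"
      using dec "2.prems" by (simp add: decreasing_tree_def)
    ultimately show ?case by (auto simp: set_revlabels)
  qed simp
  then have "sorted_wrt (<) (rev (revlabels T))"
    by (simp add: sorted_wrt_rev subtrees_self)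
  moreover have "set (rev (revlabels T)) = set [1..<Suc (length s)]"
    using dec by (auto simp: decreasing_tree_def set_revlabels)
  ultimately have "rev (revlabels T) = [1..<Suc (length s)]"
    by (intro strict_sorted_equal sorted_wrt_upt) auto
  then show ?thesis by (metis rev_rev_ident)
qed

section \<open>Counting node labels along a list of visited nodes\<close>

fun row_labels :: "nat \<Rightarrow> stree list \<Rightarrow> nat list" where
  "row_labels r [] = []"
| "row_labels r (t # ts) = r # row_labels (if t = Leaf then r else Suc r) ts"

lemma card_positions_Suc:
  "card {k. k < Suc m \<and> P k} = of_bool (P 0) + card {k. k < m \<and> P (Suc k)}"
proof -
  have "{k. k < Suc m \<and> P k} = (if P 0 then {0} else {}) \<union> Suc ` {k. k < m \<and> P (Suc k)}"
    by (auto simp: less_Suc_eq_0_disj)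
  then show ?thesis by (cases "P 0") (simp_all add: card_image card_insert_if image_iff)
qed

text \<open>The offset \<open>r\<close> counts the internal nodes visited before the list starts;
  this makes the positional definition of node labels accessible to list induction.\<close>

lemma count_row_labels:
  "card {k. k < length ts \<and> r + length (filter (\<lambda>t. t \<noteq> Leaf) (take k ts)) = i} =
     count_list (row_labels r ts) i"
proof (induction ts arbitrary: r)
  case (Cons t ts)
  define P where "P k \<longleftrightarrow> r + length (filter (\<lambda>t. t \<noteq> Leaf) (take k (t # ts))) = i" for k
  have "P 0 \<longleftrightarrow> r = i" by (simp add: P_def)
  moreover have "P (Suc k) \<longleftrightarrow>
      (if t = Leaf then r else Suc r) + length (filter (\<lambda>t. t \<noteq> Leaf) (take k ts)) = i" for k
    by (simp add: P_def)
  ultimately have "card {k. k < Suc (length ts) \<and> P k} = count_list (row_labels r (t # ts)) i"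
    unfolding card_positions_Suc by (simp only: Cons.IH) simp
  then show ?case by (simp add: P_def)
qed simp

definition forest_labels :: "stree list \<Rightarrow> nat set" where
  "forest_labels us = (\<Union>u\<in>set us. set (labels u))"

lemma forest_labels_simps [simp]:
  "forest_labels [] = {}"
  "forest_labels (u # us) = set (labels u) \<union> forest_labels us"
  "forest_labels (us @ vs) = forest_labels us \<union> forest_labels vs"
  "forest_labels (rev us) = forest_labels us"
  by (auto simp: forest_labels_def)

lemma set_labels_Node: "set (labels (Node y ts)) = insert y (forest_labels ts)"
  by (simp add: forest_labels_def)

section \<open>Tamari trees and bracket functions\<close>

context weak_composition
begin

text \<open>A state of the reverse preorder traversal consists of the number of internal nodes that remain
  to be visited, the stack of open columns, and the forest that is still to be traversed, with
  column \<open>x\<close> belonging to the tree at the same position. The first child (from the left) of a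
  node stays in the column of the node, the other ones get the new columns
  \<open>S (c - 1) + 1, \<dots>, S c\<close>, where \<open>c\<close> is the rank of the node in the traversal. A leaf in column
  \<open>x\<close> is visited in row \<open>h x\<close>.\<close>

definition new_cols :: "nat \<Rightarrow> nat list" where
  "new_cols m = rev [Suc (S (n - Suc m)) ..< Suc (S (n - m))]"

inductive traversal :: "(nat \<Rightarrow> nat) \<Rightarrow> nat \<Rightarrow> nat list \<Rightarrow> stree list \<Rightarrow> bool" for h where
  Nil: "traversal h 0 [] []"
| Leaf: "h x = n - m \<Longrightarrow> traversal h m cs us \<Longrightarrow> traversal h m (x # cs) (Leaf # us)"
| Node: "n - Suc m < h x \<Longrightarrow> Suc m \<le> n \<Longrightarrow> length ts = Suc (part s (Suc m)) \<Longrightarrow>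
    traversal h m (new_cols m @ x # cs) (rev ts @ us) \<Longrightarrow>
    traversal h (Suc m) (x # cs) (Node (Suc m) ts # us)"

lemma S_new: "Suc m \<le> n \<Longrightarrow> S (n - m) = S (n - Suc m) + part s (Suc m)"
  using S_Suc[of "n - Suc m"] by (simp add: Suc_diff_Suc)

lemma set_new_cols: "set (new_cols m) = {S (n - Suc m)<..S (n - m)}"
  by (auto simp: new_cols_def)

lemma length_new_cols: "Suc m \<le> n \<Longrightarrow> length (new_cols m) = part s (Suc m)"
  by (simp add: new_cols_def S_new)

lemma nth_new_cols: "k < part s (Suc m) \<Longrightarrow> Suc m \<le> n \<Longrightarrow> new_cols m ! k = S (n - m) - k"
  by (simp add: new_cols_def S_new rev_nth del: upt_Suc)

lemma sorted_new_cols: "sorted_wrt (>) (new_cols m)"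
  by (simp add: new_cols_def sorted_wrt_rev sorted_wrt_upt del: upt_Suc)

lemma sorted_wrt_new_cols_append:
  assumes "sorted_wrt (>) cs" "\<forall>x\<in>set cs. x \<le> S (n - Suc m)"
  shows "sorted_wrt (>) (new_cols m @ cs)"
  using assms sorted_new_cols[of m] by (fastforce simp: sorted_wrt_append set_new_cols)

lemma new_cols_append_le:
  assumes "\<forall>x\<in>set cs. x \<le> S (n - Suc m)"
  shows "\<forall>x\<in>set (new_cols m @ cs). x \<le> S (n - m)"
  using assms S_mono[of "n - Suc m" "n - m"] by (fastforce simp: set_new_cols)

lemma set_new_cols_append:
  "set (new_cols m @ cs) \<union> {S (n - m)<..W} = set cs \<union> {S (n - Suc m)<..W}"
proof -
  have "S (n - Suc m) \<le> S (n - m)" by (rule S_mono) simp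
  then show ?thesis using S_le_W[of "n - m"] by (auto simp: set_new_cols)
qed

section \<open>Invariants, uniqueness and existence of traversals\<close>

lemma traversal_length: "traversal h m cs us \<Longrightarrow> length cs = length us"
  by (induction rule: traversal.induct) (auto simp: length_new_cols)

lemma traversal_le_n: "traversal h m cs us \<Longrightarrow> m \<le> n"
  by (induction rule: traversal.induct) auto

lemma traversal_height_ge:
  "traversal h m cs us \<Longrightarrow> \<forall>x\<in>set cs. n - m \<le> h x \<and> h x \<le> n"
proof (induction rule: traversal.induct)
  case (Node m x ts cs us)
  have "n - Suc m \<le> n - m" by simp
  then show ?case using Node.IH order_trans by fastforce
qed auto

lemma traversal_revlabels:
  "traversal h m cs us \<Longrightarrow> concat (map revlabels us) = rev [1..<Suc m]"
  by (induction rule: traversal.induct) auto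

lemma traversal_labels:
  assumes "traversal h m cs us"
  shows "(\<Union>u\<in>set us. set (labels u)) = {0<..m}"
proof -
  have "set (concat (map revlabels us)) = {0<..m}"
    unfolding traversal_revlabels[OF assms] by auto
  then show ?thesis by (simp add: set_revlabels)
qed

text \<open>The last node visited is a leaf in the bottom column of the stack; by then all internal
  nodes have been visited.\<close>

lemma traversal_last: "traversal h m cs us \<Longrightarrow> if cs = [] then m = 0 else h (last cs) = n"
  by (induction rule: traversal.induct) (auto split: if_splits)

text \<open>The value \<open>h x\<close> decides whether the next node is a leaf, and the label of
  an internal node fixes its number of children, so the forest can be read off from
  \<open>h\<close>.\<close>

lemma traversal_unique: "traversal h m cs us \<Longrightarrow> traversal h m cs vs \<Longrightarrow> us = vs"
proof (induction arbitrary: vs rule: traversal.induct)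
  case Nil
  from Nil.prems show ?case by cases auto
next
  case (Leaf x m cs us)
  from Leaf.prems obtain vs' where "vs = Leaf # vs'" "traversal h m cs vs'"
    by cases (use Leaf.hyps(1) in auto)
  then show ?case using Leaf.IH by simp
next
  case (Node m x ts cs us)
  from Node.prems obtain ts' us' where "vs = stree.Node (Suc m) ts' # us'"
    "length ts' = Suc (part s (Suc m))" "traversal h m (new_cols m @ x # cs) (rev ts' @ us')"
    by cases (use Node.hyps(1) in auto)
  then show ?case using Node.IH[of "rev ts' @ us'"] Node.hyps(3) by simp
qed

text \<open>The set \<open>set cs \<union> {S (n - m)<..W}\<close> consists of the open columns and
  of those still to be opened. Visiting an internal node does not change it, so only leaves require
  an argument.\<close>

lemma traversal_bracket:
  assumes "traversal h m cs us" "sorted_wrt (>) cs" "\<forall>x\<in>set cs. x \<le> S (n - m)"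
  shows "\<forall>x\<in>set cs \<union> {S (n - m)<..W}. h x \<le> n \<and> x \<le> S (h x) \<and>
    (\<forall>x'\<in>set cs \<union> {S (n - m)<..W}. x < x' \<and> x' \<le> S (h x) \<longrightarrow> h x' \<le> h x)"
  using assms
proof (induction rule: traversal.induct)
  case (Leaf x m cs us)
  let ?D = "set cs \<union> {S (n - m)<..W}"
  have IH: "\<forall>z\<in>?D. h z \<le> n \<and> z \<le> S (h z) \<and>
    (\<forall>x'\<in>?D. z < x' \<and> x' \<le> S (h z) \<longrightarrow> h x' \<le> h z)"
    using Leaf by auto
  have "x \<le> S (h x)" "h x \<le> n" using Leaf.prems Leaf.hyps(1) by auto
  \<comment> \<open>The closing column is the largest open one and later columns start beyond
    \<open>S (h x)\<close>, so nestedness at \<open>x\<close> is vacuous.\<close>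
  moreover have "\<not> (x < x' \<and> x' \<le> S (h x))" if "x' \<in> ?D" for x'
    using that Leaf.prems Leaf.hyps(1) by auto
  moreover have "h x \<le> h z" if "z \<in> ?D" "z < x" for z
    using that Leaf.prems(2) Leaf.hyps(1) traversal_height_ge[OF Leaf.hyps(2)] by auto
  ultimately show ?case using IH by auto
next
  case (Node m x ts cs us)
  have "sorted_wrt (>) (new_cols m @ x # cs)"
    using sorted_wrt_new_cols_append Node.prems by blast
  moreover have "\<forall>z\<in>set (new_cols m @ x # cs). z \<le> S (n - m)"
    using new_cols_append_le Node.prems by blast
  ultimately show ?case using Node.IH unfolding set_new_cols_append by blast
qed auto

lemma traversal_exists:
  assumes h: "bracket h" and "m \<le> n" "sorted_wrt (>) cs"
    "\<forall>x\<in>set cs. x \<le> S (n - m) \<and> n - m \<le> h x" "if cs = [] then m = 0 else last cs = 0"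
  shows "\<exists>us. traversal h m cs us"
  using assms(2-)
proof (induction m arbitrary: cs)
  case 0
  then show ?case
  proof (induction cs)
    case (Cons x cs)
    have "\<exists>us. traversal h 0 cs us" using Cons by (auto split: if_splits)
    moreover have "h x = n - 0" using Cons.prems bracket_le[OF h, of x] by auto
    ultimately show ?case using traversal.Leaf by blast
  qed (auto intro: traversal.Nil)
next
  case (Suc m)
  show ?case
    using Suc.prems
  proof (induction cs)
    case (Cons x cs)
    show ?case
    proof (cases "h x = n - Suc m")
      case True
      \<comment> \<open>The bottom of the stack is column 0, which stops only in row
        \<open>n\<close>.\<close>
      have "cs \<noteq> []"
        using True Cons.prems(1,4) bracket_0[OF h] by auto
      then have "\<exists>us. traversal h (Suc m) cs us" using Cons by auto
      then show ?thesis using traversal.Leaf[of h x "Suc m"] True by blast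
    next
      case False
      then have less: "n - Suc m < h x" using Cons.prems(3) by auto
      have x: "x \<le> S (n - Suc m)" using Cons.prems(3) by auto
      \<comment> \<open>No open column may stop before the next row: deeper columns have
        \<open>x\<close> nested below them, and new ones start beyond the end of row
        \<open>n - Suc m\<close>.\<close>
      have "n - m \<le> h z" if z: "z \<in> set (new_cols m @ x # cs)" for z
      proof -
        consider "z = x" | "z \<in> set cs" | "S (n - Suc m) < z" "z \<le> S (n - m)"
          using z by (auto simp: set_new_cols)
        then have "n - Suc m < h z"
        proof cases
          case 2
          then have "z < x" "n - Suc m \<le> h z" using Cons.prems(2,3) by auto
          then have "h x \<le> h z"
            using bracket_nested[OF h, of z x] x S_mono[of "n - Suc m" "h z"] by simp
          then show ?thesis using less by simp
        next
          case 3
          then have "z \<le> S (h z)" using bracket_below[OF h] S_le_W order_trans by blast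
          then show ?thesis using 3 less_of_S_less by (meson order_less_le_trans)
        qed (use less in simp)
        then show ?thesis using Cons.prems(1) by simp
      qed
      moreover have "sorted_wrt (>) (new_cols m @ x # cs)"
        using sorted_wrt_new_cols_append Cons.prems(2,3) by blast
      moreover have "\<forall>z\<in>set (new_cols m @ x # cs). z \<le> S (n - m)"
        using new_cols_append_le[of "x # cs"] Cons.prems(3) by blast
      moreover have "last (new_cols m @ x # cs) = 0" using Cons.prems(4) by simp
      ultimately obtain vs where vs: "traversal h m (new_cols m @ x # cs) vs"
        using Suc.IH[of "new_cols m @ x # cs"] Cons.prems(1) by auto
      let ?k = "Suc (part s (Suc m))"
      have len: "length vs = ?k + length cs"
        using traversal_length[OF vs] Cons.prems(1) by (simp add: length_new_cols)
      have "traversal h m (new_cols m @ x # cs) (rev (rev (take ?k vs)) @ drop ?k vs)"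
        using vs by simp
      moreover have "length (rev (take ?k vs)) = ?k" using len by simp
      ultimately show ?thesis using traversal.Node[of m h x] less Cons.prems(1) by blast
    qed
  qed simp
qed

text \<open>The function \<open>h0\<close> prescribes values on the columns that are neither open
  nor still to be opened. This freedom lets the induction fix the height of a column once its leaf
  has been visited.\<close>

lemma exists_traversal:
  assumes "m \<le> n" "distinct cs" "\<forall>x\<in>set cs. x \<le> S (n - m)" "length cs = length us"
    "concat (map revlabels us) = rev [1..<Suc m]"
    "\<And>y ts u. u \<in> set us \<Longrightarrow> Node y ts \<in> subtrees u \<Longrightarrow> length ts = Suc (part s y)"
  shows "\<exists>h. traversal h m cs us \<and> (\<forall>x. x \<notin> set cs \<and> (x \<le> S (n - m) \<or> W < x) \<longrightarrow> h x = h0 x)"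
  using assms
proof (induction "length (concat (map rev_preorder us))" arbitrary: m cs us h0 rule: less_induct)
  case less
  show ?case
  proof (cases us)
    case Nil
    then show ?thesis using less.prems(4,5) traversal.Nil by (cases m) auto
  next
    case (Cons u us')
    then obtain x cs' where cs: "cs = x # cs'" using less.prems(4) by (cases cs) auto
    show ?thesis
    proof (cases u)
      case Leaf
      \<comment> \<open>Updating the default at the closed column \<open>x\<close> makes the
        induction hypothesis return the height \<open>n - m\<close> there.\<close>
      have "\<exists>h. traversal h m cs' us' \<and> (\<forall>z. z \<notin> set cs' \<and> (z \<le> S (n - m) \<or> W < z) \<longrightarrow>
          h z = (h0(x := n - m)) z)"
        by (rule less.hyps) (use less.prems Cons cs Leaf in auto)
      then obtain h where h: "traversal h m cs' us'"
        "\<forall>z. z \<notin> set cs' \<and> (z \<le> S (n - m) \<or> W < z) \<longrightarrow> h z = (h0(x := n - m)) z" by blast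
      have "h x = n - m" using h(2) less.prems(2,3) cs by simp
      then have "traversal h m cs us" using traversal.Leaf h(1) Cons cs Leaf by simp
      moreover have "h z = h0 z" if "z \<notin> set cs" "z \<le> S (n - m) \<or> W < z" for z
        using h(2) that cs by simp
      ultimately show ?thesis by blast
    next
      case (Node y ts)
      obtain m' where m': "m = Suc m'" using less.prems(5) Cons Node by (cases m) auto
      have rl: "y = m" "concat (map revlabels (rev ts @ us')) = rev [1..<Suc m']"
        using less.prems(5) Cons Node m' by auto
      have len: "length ts = Suc (part s y)" using less.prems(6)[of u y ts] Cons Node by simp
      let ?cs = "new_cols m' @ cs"
      have "\<exists>h. traversal h m' ?cs (rev ts @ us') \<and>
          (\<forall>z. z \<notin> set ?cs \<and> (z \<le> S (n - m') \<or> W < z) \<longrightarrow> h z = h0 z)"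
      proof (rule less.hyps)
        show "length (concat (map rev_preorder (rev ts @ us'))) < length (concat (map rev_preorder us))"
          using Cons Node by simp
        show "m' \<le> n" using less.prems(1) m' by simp
        show "distinct ?cs"
          using less.prems(2,3) m' by (fastforce simp: new_cols_def)
        show "\<forall>x\<in>set ?cs. x \<le> S (n - m')"
          using new_cols_append_le less.prems(3) m' by blast
        show "length ?cs = length (rev ts @ us')"
          using less.prems(1,4) m' Cons Node len rl(1) by (simp add: length_new_cols)
        show "concat (map revlabels (rev ts @ us')) = rev [1..<Suc m']" by (rule rl(2))
        show "length vs = Suc (part s z)" if "v \<in> set (rev ts @ us')" "Node z vs \<in> subtrees v" for z vs v
          using less.prems(6)[of u z vs] less.prems(6)[of v z vs] that Cons Node by auto
      qed
      then obtain h where h: "traversal h m' ?cs (rev ts @ us')"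
        "\<forall>z. z \<notin> set ?cs \<and> (z \<le> S (n - m') \<or> W < z) \<longrightarrow> h z = h0 z" by blast
      have "n - m' \<le> h x" using traversal_height_ge[OF h(1)] cs by auto
      then have "n - Suc m' < h x" using less.prems(1) m' by simp
      then have "traversal h m cs us"
        using traversal.Node[of m' h x ts cs' us'] h(1) less.prems(1) m' len rl(1) Cons Node cs by simp
      moreover have "h z = h0 z" if "z \<notin> set cs" "z \<le> S (n - m) \<or> W < z" for z
      proof -
        have "z \<notin> set ?cs" using that m' S_le_W[of "n - m'"] by (auto simp: set_new_cols)
        moreover have "z \<le> S (n - m') \<or> W < z"
          using that(2) S_mono[of "n - m" "n - m'"] m' by fastforce
        ultimately show ?thesis using h(2) by blast
      qed
      ultimately show ?thesis by blast
    qed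
  qed
qed

text \<open>The leaf in column \<open>x\<close> has label \<open>h x\<close>, and the internal nodes
  still to be visited contribute one label to each row from \<open>n - m\<close> to
  \<open>n - 1\<close>.\<close>

lemma count_traversal:
  assumes "traversal h m cs us" "distinct cs" "\<forall>x\<in>set cs. x \<le> S (n - m)"
  shows "count_list (row_labels (n - m) (concat (map rev_preorder us))) i =
    card {x \<in> set cs \<union> {S (n - m)<..W}. h x = i} + of_bool (n - m \<le> i \<and> i < n)"
  using assms
proof (induction rule: traversal.induct)
  case (Leaf x m cs us)
  let ?D = "{z \<in> set cs \<union> {S (n - m)<..W}. h z = i}"
  have x: "x \<notin> ?D" using Leaf.prems by auto
  have "{z \<in> set (x # cs) \<union> {S (n - m)<..W}. h z = i} = (if h x = i then insert x ?D else ?D)"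
    by auto
  then show ?case using Leaf x by (auto simp: card_insert_if)
next
  case (Node m x ts cs us)
  have "distinct (new_cols m @ x # cs)"
    using Node.prems by (fastforce simp: new_cols_def)
  moreover have "\<forall>z\<in>set (new_cols m @ x # cs). z \<le> S (n - m)"
    using new_cols_append_le Node.prems by blast
  ultimately have "count_list (row_labels (n - m) (concat (map rev_preorder (rev ts @ us)))) i =
      card {z \<in> set (x # cs) \<union> {S (n - Suc m)<..W}. h z = i} + of_bool (n - m \<le> i \<and> i < n)"
    using Node.IH unfolding set_new_cols_append by blast
  moreover have "Suc (n - Suc m) = n - m" using Node.hyps(2) by simp
  moreover have "of_bool (n - Suc m \<le> i \<and> i < n) = of_bool (n - m \<le> i \<and> i < n) + (of_bool (i = n - Suc m) :: nat)"
    using Node.hyps(2) by auto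
  ultimately show ?case by auto
qed simp

section \<open>The encoding of Tamari trees by bracket functions, starting from the root in column
  0\<close>

definition encodes :: "(nat \<Rightarrow> nat) \<Rightarrow> stree \<Rightarrow> bool" where
  "encodes h T \<longleftrightarrow> bracket h \<and> traversal h n [0] [T]"

lemma encodes_unique: "encodes h T \<Longrightarrow> encodes h T' \<Longrightarrow> T = T'"
  using traversal_unique by (fastforce simp: encodes_def)

lemma bracket_encodes: "bracket h \<Longrightarrow> \<exists>T. encodes h T"
proof -
  assume h: "bracket h"
  obtain us where us: "traversal h n [0] us"
    using traversal_exists[OF h, of n "[0]"] by auto
  moreover obtain T where "us = [T]" using traversal_length[OF us] by (cases us) auto
  ultimately show ?thesis using h by (auto simp: encodes_def)
qed

lemma tamari_encodes:
  assumes T: "tamari_tree s T"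
  shows "\<exists>h. encodes h T"
proof -
  \<comment> \<open>The default 0 gives the value that a bracket function must have beyond
    \<open>W\<close>.\<close>
  have "\<exists>h. traversal h n [0] [T] \<and> (\<forall>x. x \<notin> set [0] \<and> (x \<le> S (n - n) \<or> W < x) \<longrightarrow> h x = (\<lambda>_. 0) x)"
    by (rule exists_traversal)
      (use T tamari_revlabels[OF T] in \<open>auto simp: tamari_tree_def decreasing_tree_def\<close>)
  then obtain h where h: "traversal h n [0] [T]" "\<And>x. W < x \<Longrightarrow> h x = 0" by fastforce
  have D: "set [0] \<union> {S (n - n)<..W} = {..W}" by auto
  have "\<forall>x\<in>{..W}. h x \<le> n \<and> x \<le> S (h x) \<and> (\<forall>x'\<in>{..W}. x < x' \<and> x' \<le> S (h x) \<longrightarrow> h x' \<le> h x)"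
    using traversal_bracket[OF h(1)] unfolding D by simp
  then have *: "h x \<le> n" "x \<le> S (h x)" "x < x' \<Longrightarrow> x' \<le> S (h x) \<Longrightarrow> h x' \<le> h x"
    if "x \<le> W" "x' \<le> W" for x x'
    using that by auto
  have W: "x \<le> W" "x' \<le> W" if "x < x'" "x' \<le> S (h x)" for x x'
    using that S_le_W[of "h x"] by auto
  have "bracket h"
    unfolding bracket_def
  proof (intro conjI allI impI)
    show "h 0 = n" using traversal_last[OF h(1)] by simp
    show "h x \<le> n" "x \<le> S (h x)" if "x \<le> W" for x using *(1,2)[of x 0] that by auto
    show "h x = 0" if "W < x" for x using h(2) that .
    show "h x' \<le> h x" if "x < x' \<and> x' \<le> S (h x)" for x x' using * W that by meson
  qed
  then show ?thesis using h(1) by (auto simp: encodes_def)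
qed

lemma card_node_label:
  assumes "encodes h T"
  shows "card {k. k < length (rev_preorder T) \<and> node_label T k = i} =
    card {x. x \<le> W \<and> h x = i} + of_bool (i < n)"
proof -
  have tr: "traversal h n [0] [T]" using assms by (simp add: encodes_def)
  have "{x \<in> set [0] \<union> {S (n - n)<..W}. h x = i} = {x. x \<le> W \<and> h x = i}" by auto
  then show ?thesis
    using count_row_labels[of "rev_preorder T" 0 i] count_traversal[OF tr, of i]
    by (simp add: node_label_def)
qed

text \<open>The tree of \<open>h\<close> has the required row counts, and these counts determine the
  bracket function of any other candidate.\<close>

lemma phi_eq:
  assumes "encodes h T"
  shows "phi s T = tree h"
  unfolding phi_def
proof (rule the_equality)
  have h: "bracket h" using assms by (simp add: encodes_def)
  show "nu_tree (path_of (rev s)) (tree h) \<and> (\<forall>i. card {p \<in> tree h. snd p = i} =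
      card {k. k < length (rev_preorder T) \<and> node_label T k = i})"
    using nu_tree_tree[OF h] card_row_tree[OF h] card_node_label[OF assms] by simp
  fix F assume F: "nu_tree (path_of (rev s)) F \<and> (\<forall>i. card {p \<in> F. snd p = i} =
      card {k. k < length (rev_preorder T) \<and> node_label T k = i})"
  then obtain k where k: "bracket k" "F = tree k" using nu_tree_cases by blast
  then have "k = h"
    using F card_row_tree[OF k(1)] card_node_label[OF assms]
    by (intro bracket_eq_of_card k h) simp
  then show "F = tree h" using k by simp
qed

section \<open>Inversions and ascents\<close>

text \<open>The tree at position \<open>k\<close> ends with the leaf closing column
  \<open>cs ! k\<close>, when exactly \<open>h (cs ! k)\<close> internal nodes have been visited.
  Labels are visited in decreasing order, which puts the split at
  \<open>n - h (cs ! k)\<close>.\<close>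

lemma traversal_prefix_suffix:
  assumes "traversal h m cs us" "k < length us"
  shows "forest_labels (take (Suc k) us) = {n - h (cs ! k)<..m} \<and>
    forest_labels (drop (Suc k) us) = {0<..n - h (cs ! k)}"
  using assms
proof (induction arbitrary: k rule: traversal.induct)
  case (Leaf x m cs us)
  show ?case
  proof (cases k)
    case 0
    have "m \<le> n" using traversal_le_n[OF Leaf.hyps(2)] .
    moreover have "forest_labels us = {0<..m}"
      using traversal_labels[OF Leaf.hyps(2)] by (simp add: forest_labels_def)
    ultimately show ?thesis using 0 Leaf.hyps(1) by simp
  next
    case (Suc k')
    then show ?thesis using Leaf.IH[of k'] Leaf.prems by simp
  qed
next
  case (Node m x ts cs us)
  \<comment> \<open>One tree is replaced by its \<open>part s (Suc m) + 1\<close> children, which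
    shifts the later positions by \<open>part s (Suc m)\<close>.\<close>
  let ?k = "k + part s (Suc m)"
  have len: "length (new_cols m) = part s (Suc m)" using length_new_cols[OF Node.hyps(2)] .
  have nth: "(new_cols m @ x # cs) ! ?k = (x # cs) ! k"
    using len by (simp add: nth_append)
  have k: "?k < length (rev ts @ us)" using Node.prems Node.hyps(3) by simp
  have "(x # cs) ! k \<in> set (new_cols m @ x # cs)"
    using traversal_length[OF Node.hyps(4)] k len nth
    by (metis nth_mem)
  then have "n - m \<le> h ((x # cs) ! k)" using traversal_height_ge[OF Node.hyps(4)] by blast
  then have le: "n - h ((x # cs) ! k) \<le> m" using Node.hyps(2) by simp
  have "take (Suc ?k) (rev ts @ us) = rev ts @ take k us" using Node.hyps(3) by simp
  moreover have "drop (Suc ?k) (rev ts @ us) = drop k us" using Node.hyps(3) by simp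
  ultimately have "forest_labels ts \<union> forest_labels (take k us) = {n - h ((x # cs) ! k)<..m}"
    "forest_labels (drop k us) = {0<..n - h ((x # cs) ! k)}"
    using Node.IH[OF k] unfolding nth by simp_all
  moreover have "insert (Suc m) {n - h ((x # cs) ! k)<..m} = {n - h ((x # cs) ! k)<..Suc m}"
    using le by auto
  ultimately show ?case by (simp add: set_labels_Node del: labels.simps)
qed simp

text \<open>The column of child \<open>j\<close> of node \<open>c\<close>: child 0 inherits the
  column of \<open>c\<close>, which is the leftmost one in the row \<open>n - c\<close> where
  \<open>c\<close> is visited.\<close>

definition col :: "(nat \<Rightarrow> nat) \<Rightarrow> nat \<Rightarrow> nat \<Rightarrow> nat" where
  "col h c j = (if j = 0 then leftmost h (n - c) else S (n - c) + j)"

text \<open>The child \<open>i\<close> of node \<open>c\<close> carries the labels in \<open>{cut h c i<..cut h c (Suc i)}\<close>.\<close>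

definition cut :: "(nat \<Rightarrow> nat) \<Rightarrow> nat \<Rightarrow> nat \<Rightarrow> nat" where
  "cut h c j = (if j \<le> part s c then n - h (col h c j) else c - 1)"

text \<open>By the hypothesis on columns outside \<open>cs\<close>, only open columns pass above row
  \<open>n - m\<close> within this row. Hence the top of the stack is its leftmost column when an
  internal node is visited, as \<open>col\<close> requires.\<close>

lemma traversal_node:
  assumes "traversal h m cs us" "bracket h" "sorted_wrt (>) cs" "\<forall>x\<in>set cs. x \<le> S (n - m)"
    "\<forall>z\<le>S (n - m). z \<notin> set cs \<longrightarrow> h z \<le> n - m" "u \<in> set us" "stree.Node c ts \<in> subtrees u"
  shows "0 < c \<and> c \<le> n \<and> length ts = Suc (part s c) \<and>
    (\<forall>j\<le>part s c. forest_labels (drop j ts) = {cut h c j<..<c} \<and>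
      forest_labels (take j ts) \<subseteq> {0<..cut h c j})"
  using assms
proof (induction arbitrary: u rule: traversal.induct)
  case (Leaf x m cs us u)
  have "u \<in> set us" using Leaf.prems(5,6) by auto
  moreover have "\<forall>z\<le>S (n - m). z \<notin> set cs \<longrightarrow> h z \<le> n - m"
    using Leaf.prems(4) Leaf.hyps(1) by (metis order_refl set_ConsD)
  ultimately show ?case using Leaf.IH Leaf.prems by simp
next
  case (Node m x vs cs us u)
  have z: "h z \<le> n - m" if "z \<le> S (n - m)" "z \<notin> set (new_cols m @ x # cs)" for z
  proof -
    have "z \<le> S (n - Suc m)" using that by (auto simp: set_new_cols)
    then have "h z \<le> n - Suc m" using that Node.prems(4) by auto
    then show ?thesis by simp
  qed
  show ?case
  proof (cases "u = stree.Node (Suc m) vs \<and> c = Suc m \<and> ts = vs")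
    case False
    then have "u \<in> set us \<or> (\<exists>v\<in>set vs. stree.Node c ts \<in> subtrees v)"
      using Node.prems(5,6) by (cases "u \<in> set us") auto
    then have "\<exists>v\<in>set (rev vs @ us). stree.Node c ts \<in> subtrees v"
      using Node.prems(6) by auto
    then obtain v where v: "v \<in> set (rev vs @ us)" "stree.Node c ts \<in> subtrees v" by blast
    show ?thesis
      by (rule Node.IH[OF Node.prems(1) sorted_wrt_new_cols_append[OF Node.prems(2,3)]
          new_cols_append_le[OF Node.prems(3)] _ v]) (use z in blast)
  next
    case True
    let ?p = "part s c"
    have len: "length ts = Suc ?p" using True Node.hyps(3) by simp
    have x: "x = leftmost h (n - c)"
    proof (rule leftmost_eqI[OF Node.prems(1), symmetric])
      show "n - c < n" using True Node.hyps(2) by simp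
      show "x \<le> S (n - c)" using True Node.prems(3) by simp
      show "n - c < h x" using True Node.hyps(1) by simp
      fix z assume "z \<le> S (n - c)" "n - c < h z"
      then have "z \<in> set (x # cs)" using True Node.prems(4) by (meson not_le)
      then show "z \<le> x" using Node.prems(2) by auto
    qed
    have "forest_labels (drop j ts) = {cut h c j<..<c} \<and>
        forest_labels (take j ts) \<subseteq> {0<..cut h c j}" if j: "j \<le> ?p" for j
    proof -
      \<comment> \<open>The children are stacked from right to left, so child \<open>j\<close> is at
        position \<open>?p - j\<close>.\<close>
      let ?k = "?p - j"
      have k: "?k < length (rev ts @ us)" using len by simp
      have nth: "(new_cols m @ x # cs) ! ?k = col h c j"
        using j True x Node.hyps(2) length_new_cols[OF Node.hyps(2)] nth_new_cols[of ?k m]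
        by (auto simp: nth_append col_def S_new)
      have "take (Suc ?k) (rev ts @ us) = rev (drop j ts)"
        using j len by (simp add: take_rev)
      moreover have "drop (Suc ?k) (rev ts @ us) = rev (take j ts) @ us"
        using j len by (simp add: drop_rev)
      ultimately have "forest_labels (drop j ts) = {n - h (col h c j)<..m}"
        "forest_labels (take j ts) \<union> forest_labels us = {0<..n - h (col h c j)}"
        using traversal_prefix_suffix[OF Node.hyps(4), of ?k] k True unfolding nth by simp_all
      moreover have "{n - h (col h c j)<..m} = {n - h (col h c j)<..<c}" using True by auto
      ultimately show ?thesis using j by (auto simp: cut_def)
    qed
    then show ?thesis using len True Node.hyps(2) by simp
  qed
qed simp

section \<open>Columns and cut points of a single node\<close>

context
  fixes h assumes h: "bracket h"
begin

lemma col_le: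
  assumes "0 < c" "c \<le> n" "j \<le> part s c"
  shows "col h c j \<le> S (Suc (n - c))" "col h c j \<le> W"
proof -
  have "S (Suc (n - c)) = S (n - c) + part s c"
    using S_Suc[of "n - c"] assms by simp
  then show "col h c j \<le> S (Suc (n - c))"
    using leftmost_le[OF h, of "n - c"] assms by (cases "j = 0") (force simp: col_def)+
  then show "col h c j \<le> W" using S_le_W order_trans by blast
qed

lemma height_col:
  assumes "0 < c" "c \<le> n" "j \<le> part s c"
  shows "n - c < h (col h c j)"
proof (cases "j = 0")
  case True
  then show ?thesis using less_leftmost[OF h, of "n - c"] assms by (simp add: col_def)
next
  case False
  then have "S (n - c) < col h c j" by (simp add: col_def)
  also have "\<dots> \<le> S (h (col h c j))" using bracket_below[OF h] col_le(2) assms by blast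
  finally show ?thesis by (rule less_of_S_less)
qed

lemma cut_less:
  assumes "0 < c" "c \<le> n"
  shows "cut h c j < c"
  using height_col[OF assms, of j] assms by (auto simp: cut_def)

lemma col_less:
  assumes "0 < c" "c \<le> n" "i < j" "j \<le> part s c"
  shows "col h c i < col h c j"
  using assms leftmost_le[OF h, of "n - c"] by (cases "i = 0") (force simp: col_def)+

text \<open>Each of these columns reaches row \<open>Suc (n - c)\<close>, and this row contains all
  of them, so nestedness applies to any two.\<close>

lemma height_col_antimono:
  assumes "0 < c" "c \<le> n" "i \<le> j" "j \<le> part s c"
  shows "h (col h c j) \<le> h (col h c i)"
proof (cases "i = j")
  case False
  then have "col h c i < col h c j" using col_less assms by simp
  moreover have "Suc (n - c) \<le> h (col h c i)" using height_col[of c i] assms by simp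
  then have "col h c j \<le> S (h (col h c i))"
    using col_le(1)[of c j] S_mono[of "Suc (n - c)"] assms by (meson order_trans)
  ultimately show ?thesis by (rule bracket_nested[OF h])
qed simp

lemma cut_mono:
  assumes "0 < c" "c \<le> n" "i \<le> j"
  shows "cut h c i \<le> cut h c j"
  using height_col_antimono[OF assms] cut_less[OF assms(1,2), of i] assms
  by (auto simp: cut_def diff_le_mono2)

end

text \<open>Every column but 0 is opened by a node, which is found from the first row that contains
  the column.\<close>

lemma exists_block:
  assumes "0 < x" "x \<le> W"
  obtains c j where "0 < c" "c \<le> n" "0 < j" "j \<le> part s c" "x = S (n - c) + j"
proof -
  define i where "i = (LEAST i. x \<le> S i)"
  have i: "x \<le> S i" unfolding i_def using assms(2) by (rule LeastI)
  have "i \<noteq> 0" using i assms(1) by (metis S_0 not_le)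
  then obtain k where k: "i = Suc k" by (cases i) auto
  have "i \<le> n" unfolding i_def using assms(2) by (rule Least_le)
  have "\<not> x \<le> S k" using k not_less_Least[of k "\<lambda>i. x \<le> S i"] by (simp add: i_def)
  moreover have "S i = S k + part s (n - k)" using S_Suc[of k] k \<open>i \<le> n\<close> by simp
  ultimately show thesis
    using that[of "n - k" "x - S k"] i k \<open>i \<le> n\<close> by simp
qed

lemma block_unique:
  assumes "0 < c" "c \<le> n" "0 < j" "j \<le> part s c" "0 < c'" "c' \<le> n" "0 < j'" "j' \<le> part s c'"
    "S (n - c) + j = S (n - c') + j'"
  shows "c = c'" "j = j'"
proof -
  have less: False if "d < c" "0 < d" "c \<le> n" "0 < j" "k \<le> part s c"
    "S (n - d) + j = S (n - c) + k" for c d j k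
  proof -
    have "S (Suc (n - c)) \<le> S (n - d)" using that by (intro S_mono) simp
    moreover have "S (Suc (n - c)) = S (n - c) + part s c" using S_Suc[of "n - c"] that by simp
    ultimately show False using that by simp
  qed
  show "c = c'"
    using less[of c c' j j'] less[of c' c j' j] assms by (metis linorder_neqE_nat)
  then show "j = j'" using assms(9) by simp
qed

section \<open>Children, inversion numbers and ascents of an encoded tree\<close>

context
  fixes h T assumes hT: "encodes h T"
begin

lemma bracket_of_encodes: "bracket h"
  using hT by (simp add: encodes_def)

lemma encodes_traversal: "traversal h n [0] [T]"
  using hT by (simp add: encodes_def)

lemma encodes_distinct: "distinct (labels T)"
proof -
  have "distinct (revlabels T)"
    using traversal_revlabels[OF encodes_traversal] by simp
  then show ?thesis by (simp add: distinct_revlabels)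
qed

lemma encodes_set_labels: "set (labels T) = {0<..n}"
  using traversal_labels[OF encodes_traversal] by simp

lemma encodes_node:
  assumes "Node c ts \<in> subtrees T"
  shows "0 < c" "c \<le> n" "length ts = Suc (part s c)"
    and "\<And>j. j \<le> part s c \<Longrightarrow> forest_labels (drop j ts) = {cut h c j<..<c}"
    and "\<And>j. j \<le> part s c \<Longrightarrow> forest_labels (take j ts) \<subseteq> {0<..cut h c j}"
  using traversal_node[OF encodes_traversal bracket_of_encodes, of T c ts] assms by auto

text \<open>The children from \<open>i\<close> on carry the labels between \<open>cut h c i\<close>
  and \<open>c\<close>, so child \<open>i\<close> carries the difference of two such intervals. The
  convention that the cut after the last child is \<open>c - 1\<close> covers that child
  too.\<close>

lemma encodes_child_labels:
  assumes "Node c ts \<in> subtrees T" "i < length ts"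
  shows "set (labels (ts ! i)) = {cut h c i<..cut h c (Suc i)}"
proof -
  note N = encodes_node[OF assms(1)]
  have i: "i \<le> part s c" using N(3) assms(2) by simp
  have drop: "forest_labels (drop i ts) = set (labels (ts ! i)) \<union> forest_labels (drop (Suc i) ts)"
    using assms(2) by (metis Cons_nth_drop_Suc forest_labels_simps(2))
  have take: "set (labels (ts ! i)) \<subseteq> forest_labels (take (Suc i) ts)"
    using assms(2) by (simp add: take_Suc_conv_app_nth)
  have "set (labels (ts ! i)) \<subseteq> {cut h c i<..cut h c (Suc i)}"
  proof (cases "i = part s c")
    case True
    then have "set (labels (ts ! i)) \<subseteq> {cut h c i<..<c}" using drop N(4)[OF i] by blast
    moreover have "cut h c (Suc i) = c - 1" using True by (simp add: cut_def)
    ultimately show ?thesis by force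
  next
    case False
    then have "set (labels (ts ! i)) \<subseteq> {0<..cut h c (Suc i)}" using take N(5)[of "Suc i"] i by auto
    moreover have "set (labels (ts ! i)) \<subseteq> {cut h c i<..<c}" using drop N(4)[OF i] by blast
    ultimately show ?thesis by force
  qed
  moreover have "{cut h c i<..cut h c (Suc i)} \<subseteq> set (labels (ts ! i))"
  proof
    fix a assume a: "a \<in> {cut h c i<..cut h c (Suc i)}"
    then have "a < c" using cut_less[OF bracket_of_encodes N(1,2), of "Suc i"] by simp
    then have "a \<in> forest_labels (drop i ts)" using a N(4)[OF i] by simp
    moreover have "a \<notin> forest_labels (drop (Suc i) ts)"
      using a N(3) N(4)[of "Suc i"] i by (cases "i = part s c") auto
    ultimately show "a \<in> set (labels (ts ! i))" using drop by blast
  qed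
  ultimately show ?thesis by blast
qed

lemma in_child_iff:
  "in_child T c i a \<longleftrightarrow>
     0 < c \<and> c \<le> n \<and> i \<le> part s c \<and> cut h c i < a \<and> a \<le> cut h c (Suc i)"
proof
  assume "in_child T c i a"
  then obtain ts where "Node c ts \<in> subtrees T" "i < length ts" "a \<in> set (labels (ts ! i))"
    by (auto simp: in_child_def)
  then show "0 < c \<and> c \<le> n \<and> i \<le> part s c \<and> cut h c i < a \<and> a \<le> cut h c (Suc i)"
    using encodes_node[of c ts] encodes_child_labels[of c ts i] by auto
next
  assume *: "0 < c \<and> c \<le> n \<and> i \<le> part s c \<and> cut h c i < a \<and> a \<le> cut h c (Suc i)"
  then have "c \<in> set (labels T)" using encodes_set_labels by simp
  then obtain ts where "Node c ts \<in> subtrees T" by (auto simp: mem_labels_iff)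
  then show "in_child T c i a"
    using * encodes_node(3)[of c ts] encodes_child_labels[of c ts i] by (auto simp: in_child_def)
qed

text \<open>The condition \<open>cut h c j < a\<close> says that column \<open>S (n - c) + j\<close>
  passes above row \<open>n - a\<close>; the inversion number counts the columns opened by
  \<open>c\<close> that do so.\<close>

lemma card_inv_encodes:
  assumes "(c, a) \<in> label_pairs s"
  shows "card_inv s T c a \<le> part s c"
    and "\<And>j. 0 < j \<Longrightarrow> j \<le> part s c \<Longrightarrow> j \<le> card_inv s T c a \<longleftrightarrow> cut h c j < a"
proof -
  have ca: "0 < c" "c \<le> n" "0 < a" "a < c" using assms by (auto simp: label_pairs_def)
  note mono = cut_mono[OF bracket_of_encodes ca(1,2)]
  have "card_inv s T c a \<le> part s c \<and>
      (\<forall>j. 0 < j \<and> j \<le> part s c \<longrightarrow> (j \<le> card_inv s T c a \<longleftrightarrow> cut h c j < a))"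
  proof (cases "cut h c 0 < a")
    case True
    define P where "P i \<longleftrightarrow> a \<le> cut h c (Suc i)" for i
    define i where "i = (LEAST i. P i)"
    have top: "P (part s c)" using ca by (simp add: P_def cut_def)
    have i: "P i" "i \<le> part s c"
      using LeastI[of P, OF top] Least_le[of P, OF top] by (simp_all add: i_def)
    have "cut h c i < a"
    proof (cases i)
      case 0
      then show ?thesis using True by simp
    next
      case (Suc k)
      then have "\<not> P k" using not_less_Least[of k P] by (simp add: i_def)
      then show ?thesis using Suc by (simp add: P_def)
    qed
    then have "in_child T c i a" using i ca by (simp add: in_child_iff P_def)
    then have "card_inv s T c a = i" by (rule card_inv_child[OF encodes_distinct])
    moreover have "j \<le> i \<longleftrightarrow> cut h c j < a" for j
    proof
      show "j \<le> i \<Longrightarrow> cut h c j < a" using mono[of j i] \<open>cut h c i < a\<close> by simp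
      show "cut h c j < a \<Longrightarrow> j \<le> i"
        using mono[of "Suc i" j] i(1) by (force simp: P_def)
    qed
    ultimately show ?thesis using i(2) by simp
  next
    case False
    \<comment> \<open>Here \<open>a\<close> is below every label in the subtree of \<open>c\<close>,
      and the order of the labels leaves only the case that \<open>a\<close> is left of
      \<open>c\<close>.\<close>
    have "\<not> in_child T c i a" for i
      using False mono[of 0 i] by (auto simp: in_child_iff)
    moreover have "\<not> in_child T a i c" for i
      using ca cut_less[OF bracket_of_encodes, of a "Suc i"] by (auto simp: in_child_iff)
    moreover have "\<not> left_of T c a"
    proof
      assume "left_of T c a"
      then obtain y i j where "i < j" "in_child T y i c" "in_child T y j a"
        by (auto simp: left_of_def)
      then have "c \<le> cut h y (Suc i)" "cut h y (Suc i) \<le> cut h y j" "cut h y j < a"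
        using cut_mono[OF bracket_of_encodes, of y "Suc i" j] by (auto simp: in_child_iff)
      then show False using ca by simp
    qed
    ultimately have "left_of T a c"
      using related_cases[of a T c] ca encodes_set_labels by auto
    then have "card_inv s T c a = 0" by (simp add: card_inv_def)
    moreover have "\<not> cut h c j < a" for j using False mono[of 0 j] by simp
    ultimately show ?thesis by simp
  qed
  then show "card_inv s T c a \<le> part s c"
    and "\<And>j. 0 < j \<Longrightarrow> j \<le> part s c \<Longrightarrow> j \<le> card_inv s T c a \<longleftrightarrow> cut h c j < a"
    by blast+
qed

text \<open>The condition \<open>cut h c j < a\<close> is monotone in \<open>a\<close>, which gives
  the Tamari inequality.\<close>

lemma encodes_tamari: "tamari_tree s T"
  unfolding tamari_tree_def
proof (intro conjI allI impI)
  have "a < y" if "Node y ts \<in> subtrees T" "t \<in> set ts" "a \<in> set (labels t)" for y ts t a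
  proof -
    have "a \<in> forest_labels (drop 0 ts)" using that by (auto simp: forest_labels_def)
    then show ?thesis using encodes_node(4)[OF that(1), of 0] by simp
  qed
  moreover have "{0<..n} = {1..n}" by auto
  ultimately show "decreasing_tree s T"
    using encodes_distinct encodes_set_labels encodes_node(3) by (auto simp: decreasing_tree_def)
  fix a b c assume abc: "1 \<le> a \<and> a < b \<and> b < c \<and> c \<le> n"
  then have pairs: "(c, a) \<in> label_pairs s" "(c, b) \<in> label_pairs s"
    by (auto simp: label_pairs_def)
  show "card_inv s T c a \<le> card_inv s T c b"
    using card_inv_encodes(1)[OF pairs(1)] card_inv_encodes(2)[OF pairs(1), of "card_inv s T c a"]
      card_inv_encodes(2)[OF pairs(2), of "card_inv s T c a"] abc
    by (cases "card_inv s T c a = 0") auto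
qed

text \<open>Labels decrease away from the root, so the root carries the largest label of the
  interval.\<close>

lemma child_root:
  assumes "Node c ts \<in> subtrees T" "i < length ts" "cut h c i < cut h c (Suc i)"
  shows "\<exists>us. ts ! i = Node (cut h c (Suc i)) us"
proof -
  have lab: "set (labels (ts ! i)) = {cut h c i<..cut h c (Suc i)}"
    using encodes_child_labels assms(1,2) .
  then obtain r us where r: "ts ! i = Node r us" using assms(3) by (cases "ts ! i") auto
  then have sub: "Node r us \<in> subtrees T"
    using subtrees_child[OF assms(1)] assms(2) by (metis nth_mem)
  have "forest_labels us = {cut h r 0<..<r}" using encodes_node(4)[OF sub, of 0] by simp
  then have "\<forall>a\<in>set (labels (ts ! i)). a \<le> r"
    unfolding r set_labels_Node by auto
  moreover have "r \<in> set (labels (ts ! i))" using r by simp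
  ultimately have "r = cut h c (Suc i)" using lab assms(3) by (simp add: antisym)
  then show ?thesis using r by blast
qed

text \<open>Node \<open>a\<close> is visited in the row in which the column of the next child to its
  right stops. No earlier column stops there: one before the column of child \<open>i\<close> would
  hold that column down to the same row, and no candidate lies between the columns of children
  \<open>i\<close> and \<open>Suc i\<close>.\<close>

lemma first_col_eq_col:
  assumes c: "0 < c" "c \<le> n" "i < part s c" and less: "cut h c i < cut h c (Suc i)"
    and a: "a = cut h c (Suc i)"
  shows "n - a \<in> ascent_rows h" "first_col h (n - a) = col h c (Suc i)"
proof -
  note br = bracket_of_encodes
  let ?x = "col h c (Suc i)" and ?y = "col h c i"
  have hx: "h ?x = n - a" and a_pos: "0 < a"
    using a less c(3) bracket_le[OF br, of ?x] by (auto simp: cut_def)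
  have a_le: "a \<le> n" using a c(3) by (simp add: cut_def)
  have xW: "?x \<le> W" using col_le[OF br] c by simp
  show asc: "n - a \<in> ascent_rows h"
    using hx xW a_pos a_le by (auto simp: ascent_rows_def)
  have "cut h c i = n - h ?y" using c(3) by (simp add: cut_def)
  then have hy: "n - a < h ?y" using less a a_le by linarith
  have ac: "a < c" using cut_less[OF br] c a by blast
  let ?z = "first_col h (n - a)"
  have hz: "h ?z = n - a" using height_first_col[OF asc] .
  have "\<not> ?z < ?x"
  proof
    assume zx: "?z < ?x"
    have "S (Suc (n - c)) \<le> S (h ?z)" using hz ac c by (intro S_mono) simp
    then have "?y \<le> S (h ?z)" using col_le(1)[OF br, of c i] c by simp
    then have "\<not> ?z < ?y" using bracket_nested[OF br, of ?z ?y] hz hy by auto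
    moreover have "?z \<noteq> ?y" using hz hy by auto
    moreover have "\<not> ?y < ?z"
    proof (cases "i = 0")
      case True
      then have "?z \<le> S (n - c)" using zx by (simp add: col_def)
      moreover have "n - c < n" "n - c < h ?z" unfolding hz using ac c by linarith+
      ultimately show ?thesis
        using leftmost_ge[OF br, of "n - c" ?z] True by (simp add: col_def)
    next
      case False
      then show ?thesis using zx by (simp add: col_def)
    qed
    ultimately show False by simp
  qed
  moreover have "?z \<le> ?x" using first_col_le[OF asc xW hx] .
  ultimately show "?z = ?x" by simp
qed

text \<open>Each ascent row gives exactly one ascent: the row determines \<open>a\<close>, and
  \<open>c\<close> is the node that opened the first column stopping in it.\<close>

lemma mem_tamari_ascents_iff:
  "(a, c) \<in> tamari_ascents s T \<longleftrightarrow>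
     0 < a \<and> a \<le> n \<and> n - a \<in> ascent_rows h \<and> 0 < c \<and> c \<le> n \<and>
     (\<exists>j. 0 < j \<and> j \<le> part s c \<and> first_col h (n - a) = S (n - c) + j)"
proof
  note br = bracket_of_encodes
  assume "(a, c) \<in> tamari_ascents s T"
  then obtain ts i us where T: "Node c ts \<in> subtrees T" "i < part s c" "ts ! i = Node a us"
    by (auto simp: tamari_ascents_def)
  note N = encodes_node[OF T(1)]
  have i: "i < length ts" using T(2) N(3) by simp
  have "a \<in> set (labels (ts ! i))" using T(3) by simp
  then have less: "cut h c i < cut h c (Suc i)" using encodes_child_labels[OF T(1) i] by simp
  then have a: "a = cut h c (Suc i)" using child_root[OF T(1) i] T(3) by simp
  then have "0 < a" "a \<le> n" using less cut_less[OF br N(1,2), of "Suc i"] N(2) by auto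
  then show "0 < a \<and> a \<le> n \<and> n - a \<in> ascent_rows h \<and> 0 < c \<and> c \<le> n \<and>
     (\<exists>j. 0 < j \<and> j \<le> part s c \<and> first_col h (n - a) = S (n - c) + j)"
    using first_col_eq_col[OF N(1,2) T(2) less a] N(1,2) T(2)
    by (auto simp: col_def intro!: exI[of _ "Suc i"])
next
  note br = bracket_of_encodes
  assume R: "0 < a \<and> a \<le> n \<and> n - a \<in> ascent_rows h \<and> 0 < c \<and> c \<le> n \<and>
     (\<exists>j. 0 < j \<and> j \<le> part s c \<and> first_col h (n - a) = S (n - c) + j)"
  then obtain i where i: "i < part s c" "first_col h (n - a) = S (n - c) + Suc i"
    by (metis Suc_le_eq gr0_implies_Suc)
  then have x: "first_col h (n - a) = col h c (Suc i)" by (simp add: col_def)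
  have asc: "n - a \<in> ascent_rows h" using R by blast
  have hx: "h (col h c (Suc i)) = n - a" using height_first_col[OF asc] x by simp
  have "h (col h c i) \<noteq> n - a"
    using first_col_le[OF asc, of "col h c i"] x col_less[OF br, of c i "Suc i"]
      col_le(2)[OF br, of c i] R i(1) by auto
  then have "n - a < h (col h c i)"
    using height_col_antimono[OF br, of c i "Suc i"] hx R i(1) by simp
  then have cut: "cut h c (Suc i) = a" "cut h c i < a"
    using hx R i(1) by (auto simp: cut_def)
  have "c \<in> set (labels T)" using R encodes_set_labels by simp
  then obtain ts where ts: "Node c ts \<in> subtrees T" by (auto simp: mem_labels_iff)
  then have "i < length ts" using encodes_node(3) i(1) by simp
  then have "\<exists>us. ts ! i = Node a us" using child_root[OF ts, of i] cut by simp
  moreover have "a < c" using cut_less[OF br, of c "Suc i"] cut(1) R by simp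
  ultimately show "(a, c) \<in> tamari_ascents s T" using ts i(1) by (auto simp: tamari_ascents_def)
qed

end

text \<open>Every column but 0 has the form \<open>S (n - c) + j\<close>, and its height records
  which labels \<open>a\<close> have inversion number at least \<open>j\<close> with
  \<open>c\<close>.\<close>

lemma weak_le_iff:
  assumes h: "encodes h R" and k: "encodes k T"
  shows "weak_le s R T \<longleftrightarrow> h \<le> k"
proof
  note brs = bracket_of_encodes[OF h] bracket_of_encodes[OF k]
  assume le: "weak_le s R T"
  have "h x \<le> k x" for x
  proof -
    consider "x = 0" | "W < x" | "0 < x" "x \<le> W" by linarith
    then show ?thesis
    proof cases
      case 3
      then obtain c j where c: "0 < c" "c \<le> n" "0 < j" "j \<le> part s c" and x: "x = S (n - c) + j"
        by (rule exists_block)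
      have cut: "cut h c j = n - h x" "cut k c j = n - k x"
        using c x by (auto simp: cut_def col_def)
      show ?thesis
      proof (rule ccontr)
        assume "\<not> ?thesis"
        then have less: "cut h c j < cut k c j" using cut bracket_le[OF brs(1), of x] by simp
        \<comment> \<open>This label lies beyond the cut of \<open>h\<close> but not beyond that of
          \<open>k\<close>, so its inversion number with \<open>c\<close> is at least
          \<open>j\<close> in \<open>R\<close> only.\<close>
        let ?a = "cut k c j"
        have pair: "(c, ?a) \<in> label_pairs s"
          using less cut_less[OF brs(2) c(1,2), of j] c by (simp add: label_pairs_def)
        then have "j \<le> card_inv s R c ?a"
          using card_inv_encodes(2)[OF h pair c(3,4)] less by simp
        also have "\<dots> \<le> card_inv s T c ?a" using le pair by (auto simp: weak_le_def)
        finally show False using card_inv_encodes(2)[OF k pair c(3,4)] by simp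
      qed
    qed (use brs in \<open>simp_all add: bracket_0 bracket_outside\<close>)
  qed
  then show "h \<le> k" by (simp add: le_fun_def)
next
  assume le: "h \<le> k"
  show "weak_le s R T"
    unfolding weak_le_def
  proof (intro ballI, clarify)
    fix c a assume pair: "(c, a) \<in> label_pairs s"
    let ?j = "card_inv s R c a"
    show "?j \<le> card_inv s T c a"
    proof (cases "?j = 0")
      case False
      have j: "?j \<le> part s c" using card_inv_encodes(1)[OF h pair] .
      have "cut h c ?j < a" using card_inv_encodes(2)[OF h pair _ j] False by simp
      moreover have "h (col h c ?j) \<le> k (col k c ?j)"
        using le False by (simp add: col_def le_fun_def)
      then have "cut k c ?j \<le> cut h c ?j" using j by (simp add: cut_def diff_le_mono2)
      ultimately show ?thesis using card_inv_encodes(2)[OF k pair _ j] False by simp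
    qed simp
  qed
qed

end

section \<open>Transitive closures and pure intervals\<close>

lemma inv_chains_pair: "[c, a] \<in> inv_chains I c a \<longleftrightarrow> a < c \<and> 0 < count I (c, a)"
  by (auto simp: inv_chains_def)

lemma inv_chains_Cons:
  "c # d # e # bs \<in> inv_chains I c a \<longleftrightarrow>
     d < c \<and> 0 < count I (c, d) \<and> d # e # bs \<in> inv_chains I d a"
proof -
  have "(\<forall>i. i + 1 < length (c # d # e # bs) \<longrightarrow>
        0 < count I ((c # d # e # bs) ! i, (c # d # e # bs) ! (i + 1))) \<longleftrightarrow>
      0 < count I (c, d) \<and>
      (\<forall>i. i + 1 < length (d # e # bs) \<longrightarrow> 0 < count I ((d # e # bs) ! i, (d # e # bs) ! (i + 1)))"
    by (auto simp: nth_Cons split: nat.splits)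
  then show ?thesis
    unfolding inv_chains_def mem_Collect_eq sorted_wrt2[OF transp_on_greater] by auto
qed

lemma inv_chains_cases:
  assumes "b \<in> inv_chains I c a"
  obtains "b = [c, a]" | d e bs where "b = c # d # e # bs"
proof -
  obtain x y bs where "b = x # y # bs"
    using assms by (cases b; cases "tl b") (auto simp: inv_chains_def)
  then show thesis using assms that by (cases bs) (auto simp: inv_chains_def)
qed

lemma le_count_trans_closure_iff:
  assumes "0 < j"
  shows "j \<le> count (trans_closure I) (c, a) \<longleftrightarrow>
    (\<exists>b\<in>inv_chains I c a. j \<le> count I (b ! 0, b ! 1))"
  unfolding count_trans_closure using assms
  by (subst Max_ge_iff) (auto simp: finite_chain_counts[simplified])

context weak_composition
begin

text \<open>An ascent is recorded by the row of its \<nu>-ascent, from which \<open>c\<close> can be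
  recovered.\<close>

definition rows :: "(nat \<times> nat) set \<Rightarrow> nat set" where
  "rows A = (\<lambda>(a, c). n - a) ` A"

lemma leftmost_le_face_left:
  assumes h: "bracket h" and R: "R \<subseteq> ascent_rows h" and i: "i < n"
  shows "leftmost h i \<le> face_left h R i"
proof (cases "i \<in> R")
  case True
  then have asc: "i \<in> ascent_rows h" using R by blast
  then show ?thesis
    using leftmost_less[OF h first_col_le_W[OF asc] height_first_col[OF asc] i] True i
    by (simp add: face_left_def)
qed (use i in \<open>simp add: face_left_def\<close>)

context
  fixes h T A
  assumes hT: "encodes h T" and A: "A \<subseteq> tamari_ascents s T"
begin

lemma rows_subset: "rows A \<subseteq> ascent_rows h"
  using A mem_tamari_ascents_iff[OF hT] by (auto simp: rows_def)

lemma finite_ascents: "finite A"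
proof (rule finite_subset)
  show "A \<subseteq> {..n} \<times> {..n}" using A mem_tamari_ascents_iff[OF hT] by auto
qed simp

lemma mem_ascents_iff:
  assumes pair: "(c, a) \<in> label_pairs s"
  shows "(a, c) \<in> A \<longleftrightarrow>
    n - a \<in> rows A \<and> (\<exists>j. 0 < j \<and> j \<le> part s c \<and> first_col h (n - a) = S (n - c) + j)"
proof
  assume "(a, c) \<in> A"
  moreover from this have "n - a \<in> rows A" by (force simp: rows_def)
  ultimately show "n - a \<in> rows A \<and>
      (\<exists>j. 0 < j \<and> j \<le> part s c \<and> first_col h (n - a) = S (n - c) + j)"
    using A mem_tamari_ascents_iff[OF hT, of a c] by blast
next
  assume R: "n - a \<in> rows A \<and> (\<exists>j. 0 < j \<and> j \<le> part s c \<and> first_col h (n - a) = S (n - c) + j)"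
  then obtain a' c' where ac: "(a', c') \<in> A" "n - a = n - a'" by (auto simp: rows_def)
  then have asc: "(a', c') \<in> tamari_ascents s T" using A by blast
  have "a = a'" using ac(2) asc pair mem_tamari_ascents_iff[OF hT] by (auto simp: label_pairs_def)
  moreover have "c = c'"
    using R asc pair mem_tamari_ascents_iff[OF hT, of a' c'] \<open>a = a'\<close>
      block_unique(1)[of c _ c'] by (auto simp: label_pairs_def)
  ultimately show "(a, c) \<in> A" using ac(1) by simp
qed

definition raised_inv :: "(nat \<times> nat) multiset" where
  "raised_inv = tree_inv s T + mset_set (prod.swap ` A)"

lemma count_raised_inv:
  "count raised_inv (c, a) =
     (if (c, a) \<in> label_pairs s then card_inv s T c a + of_bool ((a, c) \<in> A) else 0)"
proof -
  have "(c, a) \<in> label_pairs s" if "(a, c) \<in> A"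
    using that A mem_tamari_ascents_iff[OF hT, of a c]
    by (auto simp: label_pairs_def tamari_ascents_def)
  moreover have "(c, a) \<in> prod.swap ` A \<longleftrightarrow> (a, c) \<in> A" by force
  ultimately show ?thesis
    using finite_ascents by (auto simp: raised_inv_def count_tree_inv count_mset_set')
qed

text \<open>If the first column stopping in row \<open>n - a\<close> is the \<open>i\<close>-th one
  opened by \<open>c\<close>, the inversion number is \<open>i - 1\<close>. Adding the ascent thus
  counts this column as if it passed above the row.\<close>

lemma le_count_raised_inv_iff:
  assumes pair: "(c, a) \<in> label_pairs s" and j: "0 < j" "j \<le> part s c"
  shows "j \<le> count raised_inv (c, a) \<longleftrightarrow>
    n - a < h (S (n - c) + j) \<or> n - a \<in> rows A \<and> first_col h (n - a) = S (n - c) + j"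
    and "count raised_inv (c, a) \<le> part s c"
proof -
  note br = bracket_of_encodes[OF hT]
  have ac: "0 < a" "a < c" "c \<le> n" "0 < c" using pair by (auto simp: label_pairs_def)
  have card: "i \<le> card_inv s T c a \<longleftrightarrow> n - a < h (S (n - c) + i)" if "0 < i" "i \<le> part s c" for i
  proof -
    have "cut h c i < a \<longleftrightarrow> n - a < h (S (n - c) + i)"
      using that ac bracket_le[OF br, of "S (n - c) + i"] by (auto simp: cut_def col_def)
    then show ?thesis using card_inv_encodes(2)[OF hT pair that] by simp
  qed
  have "(j \<le> count raised_inv (c, a) \<longleftrightarrow>
      n - a < h (S (n - c) + j) \<or> n - a \<in> rows A \<and> first_col h (n - a) = S (n - c) + j) \<and>
    count raised_inv (c, a) \<le> part s c"
  proof (cases "(a, c) \<in> A")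
    case False
    then have "\<not> (n - a \<in> rows A \<and> first_col h (n - a) = S (n - c) + j)"
      using mem_ascents_iff[OF pair] j by blast
    then show ?thesis
      using False card[OF j] pair card_inv_encodes(1)[OF hT pair] by (auto simp: count_raised_inv)
  next
    case True
    then obtain i where i: "0 < i" "i \<le> part s c" and x: "first_col h (n - a) = S (n - c) + i"
      and R: "n - a \<in> rows A"
      using mem_ascents_iff[OF pair] by blast
    have asc: "n - a \<in> ascent_rows h" using R rows_subset by blast
    have hx: "h (col h c i) = n - a" using height_first_col[OF asc] x i by (simp add: col_def)
    have below: "n - a < h (col h c k)" if "0 < k" "k < i" for k
    proof -
      have "h (col h c k) \<noteq> n - a"
        using first_col_le[OF asc, of "col h c k"] x that i col_le(2)[OF br ac(4,3), of k]
        by (auto simp: col_def)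
      then show ?thesis using height_col_antimono[OF br ac(4,3), of k i] that i hx by simp
    qed
    have eq: "card_inv s T c a = i - 1"
    proof (rule antisym)
      show "card_inv s T c a \<le> i - 1"
        using card[OF i] hx i by (simp add: col_def)
      show "i - 1 \<le> card_inv s T c a"
        using card[of "i - 1"] below[of "i - 1"] i by (cases "i = 1") (auto simp: col_def)
    qed
    have "n - a < h (S (n - c) + j) \<longleftrightarrow> j < i"
      using card[OF j] eq i by auto
    moreover have "first_col h (n - a) = S (n - c) + j \<longleftrightarrow> j = i" using x by auto
    ultimately show ?thesis using True pair eq i R by (auto simp: count_raised_inv)
  qed
  then show "j \<le> count raised_inv (c, a) \<longleftrightarrow>
    n - a < h (S (n - c) + j) \<or> n - a \<in> rows A \<and> first_col h (n - a) = S (n - c) + j"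
    and "count raised_inv (c, a) \<le> part s c"
    by blast+
qed

lemma count_raised_inv_le:
  assumes "0 < j" "j \<le> count raised_inv (c, a)"
  shows "(c, a) \<in> label_pairs s" "j \<le> part s c"
proof -
  show pair: "(c, a) \<in> label_pairs s" using assms by (simp add: count_raised_inv split: if_splits)
  have "count raised_inv (c, a) \<le> part s c"
  proof (cases "0 < part s c")
    case True
    then show ?thesis using le_count_raised_inv_iff(2)[OF pair, of 1] by simp
  next
    case False
    then have "(a, c) \<notin> A" using mem_ascents_iff[OF pair] by auto
    then show ?thesis
      using card_inv_encodes(1)[OF hT pair] pair by (simp add: count_raised_inv)
  qed
  then show "j \<le> part s c" using assms(2) by simp
qed

abbreviation left :: "nat \<Rightarrow> nat" where
  "left \<equiv> face_left h (rows A)"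

section \<open>Chains of inversions and the raised bracket function\<close>

lemma block_le_S:
  assumes "0 < c" "c \<le> n" "j \<le> part s c" "n - c < i"
  shows "S (n - c) + j \<le> S i"
proof -
  have "S (n - c) + j \<le> S (Suc (n - c))" using assms S_Suc[of "n - c"] by simp
  also have "\<dots> \<le> S i" using assms(4) by (intro S_mono) simp
  finally show ?thesis .
qed

text \<open>Either the column passes above row \<open>i\<close>, so the leftmost point of the row is
  not before it, or it stops in row \<open>i = n - a\<close> as the first point left after the
  removal.\<close>

lemma left_ge_step:
  assumes pos: "0 < j" and le: "j \<le> count raised_inv (c, a)" and i: "n - c < i" "i \<le> n - a"
  shows "S (n - c) + j \<le> left i"
proof -
  note br = bracket_of_encodes[OF hT]
  have pair: "(c, a) \<in> label_pairs s" and j: "j \<le> part s c"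
    using count_raised_inv_le[OF pos le] by auto
  have ac: "0 < a" "a < c" "c \<le> n" using pair by (auto simp: label_pairs_def)
  let ?x = "S (n - c) + j"
  have xS: "?x \<le> S i" using block_le_S ac j i(1) by simp
  have "i < n" using i(2) ac by linarith
  show ?thesis
  proof (cases "i < h ?x")
    case True
    then show ?thesis
      using leftmost_ge[OF br \<open>i < n\<close> xS] leftmost_le_face_left[OF br rows_subset \<open>i < n\<close>] by simp
  next
    case False
    then have R: "n - a \<in> rows A" and x: "first_col h (n - a) = ?x"
      using le_count_raised_inv_iff(1)[OF pair pos j] le i(2) by auto
    have "h ?x = n - a" using R rows_subset height_first_col x by (metis subsetD)
    then have "i = n - a" using False i(2) by simp
    then show ?thesis using R x \<open>i < n\<close> by (simp add: face_left_def)
  qed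
qed

text \<open>The first link settles the rows up to \<open>n - d\<close>. Beyond them the induction
  hypothesis for a single column suffices, because the columns opened by \<open>d\<close> lie after
  those opened by \<open>c\<close>; so only the first multiplicity of the chain matters.\<close>

lemma left_ge_chain:
  assumes "b \<in> inv_chains raised_inv c a" "0 < j" "j \<le> count raised_inv (b ! 0, b ! 1)"
  shows "(c, a) \<in> label_pairs s \<and> j \<le> part s c \<and>
    (\<forall>i. n - c < i \<and> i \<le> n - a \<longrightarrow> S (n - c) + j \<le> left i)"
  using assms
proof (induction b arbitrary: c j)
  case (Cons c' b)
  from Cons.prems(1) show ?case
  proof (cases rule: inv_chains_cases)
    case 1
    then have "j \<le> count raised_inv (c, a)" using Cons.prems by simp
    then show ?thesis
      using Cons.prems(2) count_raised_inv_le[of j c a] left_ge_step[of j c a] by auto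
  next
    case (2 d e bs)
    then have b: "b = d # e # bs" and j: "j \<le> count raised_inv (c, d)" using Cons.prems by auto
    have chain: "d < c" "b \<in> inv_chains raised_inv d a"
      using Cons.prems(1) 2 b by (simp_all add: inv_chains_Cons)
    have pair: "(c, d) \<in> label_pairs s" and jp: "j \<le> part s c"
      using count_raised_inv_le[OF Cons.prems(2) j] by auto
    have "0 < count raised_inv (d, e)"
      using chain(2) b unfolding inv_chains_def by fastforce
    then have IH: "(d, a) \<in> label_pairs s" "part s d \<ge> 1"
      "\<And>i. n - d < i \<Longrightarrow> i \<le> n - a \<Longrightarrow> S (n - d) + 1 \<le> left i"
      using Cons.IH[OF chain(2), of 1] b by auto
    have "S (n - c) + j \<le> left i" if i: "n - c < i" "i \<le> n - a" for i
    proof (cases "i \<le> n - d")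
      case True
      then show ?thesis using left_ge_step[OF Cons.prems(2) j i(1)] by simp
    next
      case False
      have "S (n - c) + j \<le> S (n - d)"
        using pair jp chain(1) by (intro block_le_S) (auto simp: label_pairs_def)
      then show ?thesis using IH(3)[of i] False i by simp
    qed
    then show ?thesis using pair IH(1) jp by (auto simp: label_pairs_def)
  qed
qed (simp add: inv_chains_def)

text \<open>The chain is found by following column \<open>x\<close> upwards: if it stops too early, it does so in a
  row whose leftmost point has been removed, which gives the first link of the chain.\<close>

lemma chain_of_left_ge:
  assumes "(c, a) \<in> label_pairs s" "0 < j" "j \<le> part s c"
    "\<And>i. n - c < i \<Longrightarrow> i \<le> n - a \<Longrightarrow> S (n - c) + j \<le> left i"
  shows "\<exists>b\<in>inv_chains raised_inv c a. j \<le> count raised_inv (b ! 0, b ! 1)"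
  using assms
proof (induction c arbitrary: j rule: less_induct)
  case (less c)
  note br = bracket_of_encodes[OF hT]
  have ac: "0 < a" "a < c" "c \<le> n" "0 < c" using less.prems(1) by (auto simp: label_pairs_def)
  let ?x = "S (n - c) + j"
  have xW: "?x \<le> W" using block_le_S[of c j n] ac less.prems(3) by simp
  show ?case
  proof (cases "j \<le> count raised_inv (c, a)")
    case True
    then have "0 < count raised_inv (c, a)" using less.prems(2) by linarith
    then have "[c, a] \<in> inv_chains raised_inv c a"
      using ac by (simp add: inv_chains_pair)
    then show ?thesis using True by (intro bexI) simp_all
  next
    case False
    define i where "i = h ?x"
    have F: "\<not> n - a < i" "\<not> (n - a \<in> rows A \<and> first_col h (n - a) = ?x)"
      using False le_count_raised_inv_iff(1)[OF less.prems(1-3)] by (auto simp: i_def)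
    have "S (n - c) < ?x" using less.prems(2) by simp
    also have "?x \<le> S i" using bracket_below[OF br xW] by (simp add: i_def)
    finally have ci: "n - c < i" by (rule less_of_S_less)
    have i_n: "i < n" using F(1) ac by linarith
    have "?x \<le> left i" using less.prems(4)[OF ci] F(1) by simp
    then have R: "i \<in> rows A" "?x = first_col h i"
      using face_left_top[OF br rows_subset xW i_def[symmetric] i_n] by auto
    then have i_a: "i < n - a" using F by (metis linorder_neqE_nat)
    define d where "d = n - i"
    have d: "a < d" "d < c" "n - d = i" "0 < d" "d \<le> n"
      using i_a ci i_n ac by (auto simp: d_def)
    have pair: "(c, d) \<in> label_pairs s" "(d, a) \<in> label_pairs s"
      using d ac by (auto simp: label_pairs_def)
    have cd: "j \<le> count raised_inv (c, d)"
      using le_count_raised_inv_iff(1)[OF pair(1) less.prems(2,3)] R d(3) by simp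
    \<comment> \<open>Nestedness holds all columns from \<open>?x\<close> to \<open>S i\<close> down
      to row \<open>i\<close>, so a face point in a higher row and not before \<open>?x\<close> lies
      beyond \<open>S i\<close>. For \<open>k = Suc i\<close> this shows that \<open>d\<close> opens
      at least one column.\<close>
    have left: "S i < left k" "left k \<le> S k" if k: "i < k" "k \<le> n - a" for k
    proof -
      let ?z = "left k"
      have z: "(?z, k) \<in> face h (rows A)"
        using face_left_in_face[OF br rows_subset, of k] k by simp
      then have zk: "(?z, k) \<in> tree h" using face_subset_tree by blast
      then show "?z \<le> S k" by (rule tree_below[OF br])
      have xz: "?x \<le> ?z" using less.prems(4)[of k] ci k by simp
      show "S i < ?z"
      proof (rule ccontr)
        assume "\<not> ?thesis"
        then have "h ?z \<le> i"
          using bracket_nested[OF br, of ?x ?z] xz by (cases "?x = ?z") (auto simp: i_def)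
        then show False using tree_le_top[OF br zk] k by simp
      qed
    qed
    have "S (Suc i) = S i + part s d" using S_Suc[OF i_n] by (simp add: d_def)
    then have "1 \<le> part s d" using left[of "Suc i"] i_a by simp
    moreover have "S (n - d) + 1 \<le> left k" if "n - d < k" "k \<le> n - a" for k
      using left(1)[of k] that d(3) by simp
    ultimately obtain b where b: "b \<in> inv_chains raised_inv d a"
      using less.IH[OF d(2) pair(2), of 1] by auto
    have pos: "0 < count raised_inv (c, d)" using cd less.prems(2) by linarith
    have "c # b \<in> inv_chains raised_inv c a \<and> (c # b) ! 1 = d"
      using b
    proof (cases rule: inv_chains_cases)
      case 1
      then show ?thesis
      using b pos d(2) inv_chains_Cons[of c d a "[]"] by simp
    next
      case (2 e f bs)
      then show ?thesis
      using b pos d(2) inv_chains_Cons[of c d e "f # bs"] by simp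
    qed
    then show ?thesis using cd by (intro bexI[of _ "c # b"]) simp_all
  qed
qed

text \<open>The rows up to \<open>n - c\<close> end before this column, so only a later row with a
  face point to its left can stop it.\<close>

lemma less_raise_iff:
  assumes "(c, a) \<in> label_pairs s" "0 < j" "j \<le> part s c"
  shows "n - a < raise h (rows A) (S (n - c) + j) \<longleftrightarrow>
    (\<forall>i. n - c < i \<and> i \<le> n - a \<longrightarrow> S (n - c) + j \<le> left i)"
proof -
  have ac: "0 < a" "a < c" "c \<le> n" "0 < c" using assms(1) by (auto simp: label_pairs_def)
  let ?x = "S (n - c) + j"
  have x: "0 < ?x" "?x \<le> W" using block_le_S[of c j n] ac assms(2,3) by simp_all
  have xS: "?x \<le> S i" if "n - c < i" for i using block_le_S that ac assms(3) by simp
  have "S (n - c) < ?x" using assms(2) by simp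
  also have "?x \<le> S (raise h (rows A) ?x)" using raise_below[OF x] .
  finally have "n - c < raise h (rows A) ?x" by (rule less_of_S_less)
  then show ?thesis
    using le_face_left[OF xS, of _ h "rows A"] face_left_raise[OF x, of h "rows A"]
    by (meson not_le order_le_less_trans)
qed

text \<open>Multiplicities are compared through their thresholds \<open>j\<close>: both sides say
  that, in the rows after \<open>n - c\<close> up to \<open>n - a\<close>, the face has no point
  before column \<open>S (n - c) + j\<close>.\<close>

lemma trans_closure_raised_inv:
  assumes Q: "encodes (raise h (rows A)) Q"
  shows "tree_inv s Q = trans_closure raised_inv"
proof (rule multiset_eqI)
  fix p :: "nat \<times> nat"
  obtain c a where p: "p = (c, a)" by force
  have "j \<le> count (tree_inv s Q) (c, a) \<longleftrightarrow> j \<le> count (trans_closure raised_inv) (c, a)" if "0 < j" for j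
  proof -
    have "j \<le> count (tree_inv s Q) (c, a) \<longleftrightarrow>
        (c, a) \<in> label_pairs s \<and> j \<le> part s c \<and> n - a < raise h (rows A) (S (n - c) + j)"
    proof (cases "(c, a) \<in> label_pairs s \<and> j \<le> part s c")
      case True
      then have "0 < a" "a < c" "c \<le> n" by (auto simp: label_pairs_def)
      then have "cut (raise h (rows A)) c j < a \<longleftrightarrow> n - a < raise h (rows A) (S (n - c) + j)"
        using that True bracket_le[OF bracket_raise, of h "rows A" "S (n - c) + j"]
        by (auto simp: cut_def col_def)
      then show ?thesis
        using True that card_inv_encodes(2)[OF Q, of c a j] by (simp add: count_tree_inv)
    next
      case False
      then show ?thesis
        using that card_inv_encodes(1)[OF Q, of c a] by (auto simp: count_tree_inv)
    qed
    also have "\<dots> \<longleftrightarrow> (\<exists>b\<in>inv_chains raised_inv c a. j \<le> count raised_inv (b ! 0, b ! 1))"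
      using less_raise_iff[of c a j] left_ge_chain[of _ c a j] chain_of_left_ge[of c a j] that
      by blast
    also have "\<dots> \<longleftrightarrow> j \<le> count (trans_closure raised_inv) (c, a)"
      using le_count_trans_closure_iff[OF that] by blast
    finally show ?thesis .
  qed
  then show "count (tree_inv s Q) p = count (trans_closure raised_inv) p"
    unfolding p by (metis antisym le0 linorder_not_less order_refl)
qed

text \<open>Equal inversion multi-sets give comparisons in both directions of the weak order, hence
  equal bracket functions and equal trees.\<close>

lemma tree_plus_eq:
  assumes Q: "encodes (raise h (rows A)) Q"
  shows "tree_plus s T A = Q"
  unfolding tree_plus_def
proof (rule the_equality)
  show "tamari_tree s Q \<and> tree_inv s Q = trans_closure (tree_inv s T + mset_set (prod.swap ` A))"
    using encodes_tamari[OF Q] trans_closure_raised_inv[OF Q] by (simp add: raised_inv_def)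
  fix R
  assume R: "tamari_tree s R \<and>
    tree_inv s R = trans_closure (tree_inv s T + mset_set (prod.swap ` A))"
  then obtain k where k: "encodes k R" using tamari_encodes by blast
  have "tree_inv s R = tree_inv s Q"
    using R trans_closure_raised_inv[OF Q] by (simp add: raised_inv_def)
  then have "card_inv s R c a = card_inv s Q c a" if "(c, a) \<in> label_pairs s" for c a
    using count_tree_inv[of s R c a] count_tree_inv[of s Q c a] that by simp
  then have "weak_le s R Q" "weak_le s Q R" by (auto simp: weak_le_def)
  then have "k = raise h (rows A)" using weak_le_iff k Q by (meson antisym)
  then show "R = Q" using encodes_unique k Q by simp
qed

end

section \<open>From ascents and pure intervals to faces\<close>

lemma nu_ascent_of_eq:
  assumes hT: "encodes h T" and ac: "(a, c) \<in> tamari_ascents s T"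
  shows "nu_ascent_of s T (a, c) = (leftmost h (n - a), n - a)"
proof -
  have A: "{(a, c)} \<subseteq> tamari_ascents s T" using ac by simp
  have rows: "rows {(a, c)} = {n - a}" by (simp add: rows_def)
  obtain Q where Q: "encodes (raise h (rows {(a, c)})) Q"
    using bracket_encodes[OF bracket_raise] by blast
  have "phi s (tree_plus s T {(a, c)}) = tree (raise h {n - a})"
    using tree_plus_eq[OF hT A Q] phi_eq[OF Q] rows by simp
  moreover have "n - a \<in> ascent_rows h" using rows_subset[OF hT A] rows by simp
  ultimately have "nu_rotation (phi s T) (leftmost h (n - a), n - a) (phi s (tree_plus s T {(a, c)}))"
    using nu_rotation_raise[OF bracket_of_encodes[OF hT]] phi_eq[OF hT] by simp
  then show ?thesis
    unfolding nu_ascent_of_def using nu_rotation_unique by blast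
qed

lemma phi_minus_ascents:
  assumes hT: "encodes h T" and A: "A \<subseteq> tamari_ascents s T"
  shows "phi s T - nu_ascent_of s T ` A = face h (rows A)"
proof -
  have "nu_ascent_of s T ` A = (\<lambda>(a, c). (leftmost h (n - a), n - a)) ` A"
    using nu_ascent_of_eq[OF hT] A by (intro image_cong) auto
  also have "\<dots> = (\<lambda>i. (leftmost h i, i)) ` rows A"
    by (simp add: rows_def image_image case_prod_unfold)
  finally show ?thesis using phi_eq[OF hT] by (simp add: face_def)
qed

text \<open>In terms of bracket functions the interval is \<open>h \<le> k\<close> and
  \<open>k \<le> raise h (rows A)\<close>, and these bounds characterize the trees containing the
  face.\<close>

lemma tamari_interval_eq:
  assumes hT: "encodes h T" and A: "A \<subseteq> tamari_ascents s T"
  shows "tamari_interval s T (tree_plus s T A) =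
    {R. tamari_tree s R \<and> face h (rows A) \<subseteq> phi s R}"
proof -
  obtain Q where Q: "encodes (raise h (rows A)) Q"
    using bracket_encodes[OF bracket_raise] by blast
  have "weak_le s T R \<and> weak_le s R Q \<longleftrightarrow> face h (rows A) \<subseteq> phi s R" if R: "tamari_tree s R" for R
  proof -
    obtain k where k: "encodes k R" using tamari_encodes[OF R] by blast
    show ?thesis
      using weak_le_iff[OF hT k] weak_le_iff[OF k Q] phi_eq[OF k]
        face_subset_tree_iff[OF bracket_of_encodes[OF hT] rows_subset[OF hT A] bracket_of_encodes[OF k]]
      by simp
  qed
  then show ?thesis unfolding tamari_interval_def tree_plus_eq[OF hT A Q] by blast
qed

text \<open>The \<nu>-trees of the two end points already intersect in the face.\<close>

lemma Inter_phi_interval: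
  assumes hT: "encodes h T" and A: "A \<subseteq> tamari_ascents s T"
  shows "\<Inter>(phi s ` tamari_interval s T (tree_plus s T A)) = face h (rows A)"
proof
  note br = bracket_of_encodes[OF hT] and R = rows_subset[OF hT A]
  obtain Q where Q: "encodes (raise h (rows A)) Q"
    using bracket_encodes[OF bracket_raise] by blast
  have "{T, Q} \<subseteq> tamari_interval s T (tree_plus s T A)"
    unfolding tamari_interval_eq[OF hT A]
    using encodes_tamari[OF hT] encodes_tamari[OF Q] phi_eq[OF hT] phi_eq[OF Q]
      face_subset_tree face_subset_tree_raise[OF br R] by simp
  then have "\<Inter>(phi s ` tamari_interval s T (tree_plus s T A)) \<subseteq> phi s T \<inter> phi s Q" by blast
  also have "\<dots> = face h (rows A)"
    using tree_Int_tree_raise[OF br R] phi_eq[OF hT] phi_eq[OF Q] by simp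
  finally show "\<Inter>(phi s ` tamari_interval s T (tree_plus s T A)) \<subseteq> face h (rows A)" .
  show "face h (rows A) \<subseteq> \<Inter>(phi s ` tamari_interval s T (tree_plus s T A))"
    unfolding tamari_interval_eq[OF hT A] by blast
qed

text \<open>For each row in \<open>R\<close>, the first column stopping there is positive, so some
  node \<open>c\<close> opens it; this \<open>c\<close> completes the ascent.\<close>

lemma exists_ascents:
  assumes hT: "encodes h T" and R: "R \<subseteq> ascent_rows h"
  obtains A where "A \<subseteq> tamari_ascents s T" "rows A = R"
proof
  let ?A = "{(a, c) \<in> tamari_ascents s T. n - a \<in> R}"
  show "?A \<subseteq> tamari_ascents s T" by blast
  show "rows ?A = R"
  proof
    show "rows ?A \<subseteq> R" by (auto simp: rows_def)
    show "R \<subseteq> rows ?A"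
    proof
      fix i assume i: "i \<in> R"
      then have asc: "i \<in> ascent_rows h" using R by blast
      then have i_n: "i < n" by (simp add: ascent_rows_def)
      obtain c j where "0 < c" "c \<le> n" "0 < j" "j \<le> part s c" "first_col h i = S (n - c) + j"
        using exists_block[OF first_col_pos[OF bracket_of_encodes[OF hT] asc] first_col_le_W[OF asc]] .
      then have "(n - i, c) \<in> ?A"
        using i asc i_n mem_tamari_ascents_iff[OF hT, of "n - i" c] by auto
      then show "i \<in> rows ?A" using i_n by (force simp: rows_def)
    qed
  qed
qed

text \<open>The face is the intersection of the \<nu>-trees of all elements of the interval, so it
  does not depend on the choice of \<open>T\<close> and \<open>A\<close>.\<close>

lemma phi_bar_eq:
  assumes T: "tamari_tree s T" and A: "A \<subseteq> tamari_ascents s T"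
  shows "phi_bar s (tamari_interval s T (tree_plus s T A)) = phi s T - nu_ascent_of s T ` A"
  unfolding phi_bar_def
proof (rule the_equality)
  have Inter: "\<Inter>(phi s ` tamari_interval s T' (tree_plus s T' A')) = phi s T' - nu_ascent_of s T' ` A'"
    if "tamari_tree s T'" "A' \<subseteq> tamari_ascents s T'" for T' A'
    using tamari_encodes[OF that(1)] Inter_phi_interval phi_minus_ascents that(2) by metis
  show "\<exists>T' A'. tamari_tree s T' \<and> A' \<subseteq> tamari_ascents s T' \<and>
      tamari_interval s T (tree_plus s T A) = tamari_interval s T' (tree_plus s T' A') \<and>
      phi s T - nu_ascent_of s T ` A = phi s T' - nu_ascent_of s T' ` A'"
    using T A by blast
  show "F = phi s T - nu_ascent_of s T ` A"
    if "\<exists>T' A'. tamari_tree s T' \<and> A' \<subseteq> tamari_ascents s T' \<and>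
      tamari_interval s T (tree_plus s T A) = tamari_interval s T' (tree_plus s T' A') \<and>
      F = phi s T' - nu_ascent_of s T' ` A'" for F
    using that Inter T A by metis
qed

lemma asso_s_cases:
  assumes "I \<in> asso_s s"
  obtains h R T where "encodes h T" "R \<subseteq> ascent_rows h" "phi_bar s I = face h R"
    "I = {Q. tamari_tree s Q \<and> face h R \<subseteq> phi s Q}" "\<Inter>(phi s ` I) = face h R"
proof -
  obtain T A where T: "tamari_tree s T" and A: "A \<subseteq> tamari_ascents s T"
    and I: "I = tamari_interval s T (tree_plus s T A)"
    using assms by (auto simp: asso_s_def)
  obtain h where hT: "encodes h T" using tamari_encodes[OF T] by blast
  show thesis
    using that[OF hT rows_subset[OF hT A]] phi_bar_eq[OF T A] phi_minus_ascents[OF hT A]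
      tamari_interval_eq[OF hT A] Inter_phi_interval[OF hT A] I by simp
qed

text \<open>The interval consists of the trees whose images contain the face, and the face is the
  intersection of these images. Both passages reverse inclusion.\<close>

lemma phi_bar_mono_iff:
  assumes "I \<in> asso_s s" "J \<in> asso_s s"
  shows "I \<subseteq> J \<longleftrightarrow> phi_bar s J \<subseteq> phi_bar s I"
proof -
  obtain F where F: "phi_bar s I = F" "I = {Q. tamari_tree s Q \<and> F \<subseteq> phi s Q}" "\<Inter>(phi s ` I) = F"
    using asso_s_cases[OF assms(1)] by metis
  obtain G where G: "phi_bar s J = G" "J = {Q. tamari_tree s Q \<and> G \<subseteq> phi s Q}" "\<Inter>(phi s ` J) = G"
    using asso_s_cases[OF assms(2)] by metis
  show ?thesis
  proof
    assume "I \<subseteq> J"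
    then have "\<Inter>(phi s ` J) \<subseteq> \<Inter>(phi s ` I)" by blast
    then show "phi_bar s J \<subseteq> phi_bar s I" using F(1,3) G(1,3) by simp
  next
    assume "phi_bar s J \<subseteq> phi_bar s I"
    then show "I \<subseteq> J" using F(1,2) G(1,2) by blast
  qed
qed

lemma bij_betw_phi_bar: "bij_betw (phi_bar s) (asso_s s) (asso_nu (path_of (rev s)))"
proof (rule bij_betw_imageI)
  show "inj_on (phi_bar s) (asso_s s)"
    using phi_bar_mono_iff by (intro inj_onI) (metis antisym order_refl)
  show "phi_bar s ` asso_s s = asso_nu (path_of (rev s))"
  proof
    show "phi_bar s ` asso_s s \<subseteq> asso_nu (path_of (rev s))"
    proof
      fix F assume "F \<in> phi_bar s ` asso_s s"
      then obtain I where "I \<in> asso_s s" "F = phi_bar s I" by blast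
      then show "F \<in> asso_nu (path_of (rev s))"
        using asso_s_cases asso_nu_face bracket_of_encodes by metis
    qed
    show "asso_nu (path_of (rev s)) \<subseteq> phi_bar s ` asso_s s"
    proof
      fix F assume "F \<in> asso_nu (path_of (rev s))"
      then obtain h R where h: "bracket h" and R: "R \<subseteq> ascent_rows h" and F: "F = face h R"
        by (rule asso_nu_cases)
      obtain T where hT: "encodes h T" using bracket_encodes[OF h] by blast
      obtain A where A: "A \<subseteq> tamari_ascents s T" "rows A = R" using exists_ascents[OF hT R] .
      have "F = phi_bar s (tamari_interval s T (tree_plus s T A))"
        using phi_bar_eq[OF encodes_tamari[OF hT] A(1)] phi_minus_ascents[OF hT A(1)] A(2) F by simp
      moreover have "tamari_interval s T (tree_plus s T A) \<in> asso_s s"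
        using encodes_tamari[OF hT] A(1) by (auto simp: asso_s_def)
      ultimately show "F \<in> phi_bar s ` asso_s s" by blast
    qed
  qed
qed

end

theorem theorem2p9:
  fixes s :: "nat list" and \<nu> :: "step list"
  assumes "\<nu> = path_of (rev s)"
  shows "(\<forall>T A. tamari_tree s T \<and> A \<subseteq> tamari_ascents s T \<longrightarrow>
            phi_bar s (tamari_interval s T (tree_plus s T A)) = phi s T - nu_ascent_of s T ` A) \<and>
         bij_betw (phi_bar s) (asso_s s) (asso_nu \<nu>) \<and>
         (\<forall>I\<in>asso_s s. \<forall>J\<in>asso_s s. I \<subseteq> J \<longleftrightarrow> phi_bar s I \<supseteq> phi_bar s J)"
  unfolding assms
  by (intro conjI allI impI ballI weak_composition.bij_betw_phi_bar weak_composition.phi_bar_eq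
      weak_composition.phi_bar_mono_iff) simp_all

end
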